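(* Let $\lambda\ge1$. Every $\lambda$-projective Banach lattice has the lattice-lifting property with constant $\lambda$.
   Context: All Banach spaces are real; $B_E$ is the closed unit ball of $E$. A lattice homomorphism between Banach lattices is a bounded linear operator preserving lattice operations. A sublattice means a closed vector sublattice. For $\lambda\ge1$, a Banach lattice $X$ is $\lambda$-projective if whenever $Y$ is a Banach lattice, $J$ is a closed ideal of $Y$ and $Q:Y\to Y/J$ is the quotient map, then for every lattice homomorphism $T:X\to Y/J$ there is a lattice homomorphism $\hat T:X\to Y$ with $T=Q\circ\hat T$ and $\|\hat T\|\le\lambda\|T\|$. Free Banach lattice: for a Banach space $E$ and a positively homogeneous function $f:E^*\to\mathbb{R}$ (i.e. $f(\lambda x^* )=\lambda f(x^* )$ for $\lambda>0$), put $\|f\|_{FBL[E]}:=\sup\{\sum_{i=1}^n|f(x_i^* )|: n\in\mathbb{N},\ x_1^*,\dots,x_n^*\in E^*,\ \sup_{x\in B_E}\sum_{i=1}^n|x_i^*(x)|\le 1\}\in[0,\infty]$. Let $H_0[E]$ be the Banach lattice of all positively homogeneous $f$ with $\|f\|_{FBL[E]}<\infty$, with this norm and the pointwise order. $FBL[E]$ is the (closed) sublattice of $H_0[E]$ generated by $\{\delta_E(x):x\in E\}$, where $\delta_E(x)(x^* ):=x^*(x)$. The map $\delta_E:E\to FBL[E]$ is a linear isometry, and for every Banach lattice $X$ and bounded linear $T:E\to X$ there is a unique lattice homomorphism $\hat T:FBL[E]\to X$ with $\hat T\circ\delta_E=T$; moreover $\|\hat T\|=\|T\|$. For a Banach lattice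 $X$, $\beta_X:FBL[X]\to X$ is the unique lattice homomorphism with $\beta_X\circ\delta_X=id_X$. A Banach lattice $X$ has the lattice-lifting property with constant $\lambda$ if there is a lattice homomorphism $\alpha:X\to FBL[X]$ with $\|\alpha\|\le\lambda$ and $\beta_X\circ\alpha=id_X$. *)

theory Defs
  imports "HOL-Analysis.Analysis" "HOL-Algebra.Module" "HOL-Algebra.AbelCoset" "HOL-Algebra.Lattice"
begin

section \<open>Banach lattices as a type class\<close>

class banach_lattice = banach + ordered_real_vector + lattice +
  assumes norm_mono_abs: "sup x (- x) \<le> sup y (- y) \<Longrightarrow> norm x \<le> norm y"


section \<open>Banach lattices on carrier sets\<close>

text \<open>
  Ideals, quotients, generated sublattices, and the quantification over all Banach lattices in the
  definition of projectivity need Banach lattices whose elements form a set rather than a type.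
  They are modules over the field of real numbers with an order and a norm; as usual for modules,
  the ring fields \<open>mult\<close> and \<open>one\<close> carry no information.
\<close>

definition real_ring :: "real ring" where
  "real_ring = \<lparr>carrier = UNIV, mult = (*), one = 1, zero = 0, add = (+)\<rparr>"

record 'b vlattice = "(real, 'b) module" +
  vle :: "'b \<Rightarrow> 'b \<Rightarrow> bool"
  vnorm :: "'b \<Rightarrow> real"

definition vorder :: "('b, 'm) vlattice_scheme \<Rightarrow> 'b gorder" where
  "vorder Y = \<lparr>carrier = carrier Y, eq = (=), le = vle Y\<rparr>"

definition vjoin :: "('b, 'm) vlattice_scheme \<Rightarrow> 'b \<Rightarrow> 'b \<Rightarrow> 'b" where
  "vjoin Y x y = join (vorder Y) x y"

definition vmeet :: "('b, 'm) vlattice_scheme \<Rightarrow> 'b \<Rightarrow> 'b \<Rightarrow> 'b" where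
  "vmeet Y x y = meet (vorder Y) x y"

definition vabs :: "('b, 'm) vlattice_scheme \<Rightarrow> 'b \<Rightarrow> 'b" where
  "vabs Y x = vjoin Y x (\<ominus>\<^bsub>Y\<^esub> x)"

definition vtendsto :: "('b, 'm) vlattice_scheme \<Rightarrow> (nat \<Rightarrow> 'b) \<Rightarrow> 'b \<Rightarrow> bool" where
  "vtendsto Y s l \<longleftrightarrow> (\<lambda>n. vnorm Y (s n \<ominus>\<^bsub>Y\<^esub> l)) \<longlonglongrightarrow> 0"

definition vCauchy :: "('b, 'm) vlattice_scheme \<Rightarrow> (nat \<Rightarrow> 'b) \<Rightarrow> bool" where
  "vCauchy Y s \<longleftrightarrow> (\<forall>e>0. \<exists>N. \<forall>m\<ge>N. \<forall>n\<ge>N. vnorm Y (s m \<ominus>\<^bsub>Y\<^esub> s n) < e)"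

locale banach_lattice_on =
  fixes Y :: "('b, 'm) vlattice_scheme" (structure)
  assumes vector_space: "Module.module real_ring Y"
    and is_lattice: "Lattice.lattice (vorder Y)"
    and vle_add: "\<lbrakk>x \<in> carrier Y; y \<in> carrier Y; z \<in> carrier Y; vle Y x y\<rbrakk>
      \<Longrightarrow> vle Y (x \<oplus> z) (y \<oplus> z)"
    and vle_smult: "\<lbrakk>0 \<le> a; x \<in> carrier Y; y \<in> carrier Y; vle Y x y\<rbrakk>
      \<Longrightarrow> vle Y (a \<odot> x) (a \<odot> y)"
    and vnorm_nonneg: "x \<in> carrier Y \<Longrightarrow> 0 \<le> vnorm Y x"
    and vnorm_eq_0: "x \<in> carrier Y \<Longrightarrow> vnorm Y x = 0 \<longleftrightarrow> x = \<zero>"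
    and vnorm_triangle: "\<lbrakk>x \<in> carrier Y; y \<in> carrier Y\<rbrakk>
      \<Longrightarrow> vnorm Y (x \<oplus> y) \<le> vnorm Y x + vnorm Y y"
    and vnorm_smult: "x \<in> carrier Y \<Longrightarrow> vnorm Y (a \<odot> x) = \<bar>a\<bar> * vnorm Y x"
    and vnorm_mono: "\<lbrakk>x \<in> carrier Y; y \<in> carrier Y; vle Y (vabs Y x) (vabs Y y)\<rbrakk>
      \<Longrightarrow> vnorm Y x \<le> vnorm Y y"
    and complete: "\<lbrakk>\<And>n. s n \<in> carrier Y; vCauchy Y s\<rbrakk> \<Longrightarrow> \<exists>l\<in>carrier Y. vtendsto Y s l"

definition type_lattice :: "'a::banach_lattice vlattice" where
  "type_lattice = \<lparr>carrier = UNIV, mult = undefined, one = undefined, zero = 0, add = (+),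
     smult = (*\<^sub>R), vle = (\<le>), vnorm = norm\<rparr>"

lemma carrier_type_lattice [simp]: "carrier type_lattice = UNIV"
  and zero_type_lattice [simp]: "\<zero>\<^bsub>type_lattice\<^esub> = 0"
  and add_type_lattice [simp]: "x \<oplus>\<^bsub>type_lattice\<^esub> y = x + y"
  and smult_type_lattice [simp]: "a \<odot>\<^bsub>type_lattice\<^esub> x = a *\<^sub>R x"
  and vle_type_lattice [simp]: "vle type_lattice x y \<longleftrightarrow> x \<le> y"
  and vnorm_type_lattice [simp]: "vnorm type_lattice x = norm x"
  by (simp_all add: type_lattice_def)

lemma cring_real_ring: "cring real_ring"
  unfolding real_ring_def
  by (rule cringI, rule abelian_groupI, auto simp: algebra_simps
      intro!: Group.comm_monoidI exI[of _ "- _"])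

lemma abelian_group_type_lattice: "abelian_group type_lattice"
  by (rule abelian_groupI) (auto simp: algebra_simps intro: exI[of _ "- _"])

lemma minus_type_lattice [simp]:
  "\<ominus>\<^bsub>type_lattice\<^esub> x = - x" "x \<ominus>\<^bsub>type_lattice\<^esub> y = x - y"
proof -
  interpret abelian_group "type_lattice :: 'a vlattice"
    by (rule abelian_group_type_lattice)
  show neg: "\<ominus>\<^bsub>type_lattice\<^esub> x = - x" for x :: 'a
    by (rule minus_equality) auto
  show "x \<ominus>\<^bsub>type_lattice\<^esub> y = x - y"
    unfolding a_minus_def neg by simp
qed

lemma vorder_type_lattice:
  fixes x y :: "'a::banach_lattice"
  shows "Lattice.lattice (vorder (type_lattice :: 'a vlattice))" (is "Lattice.lattice ?L")
    and vjoin_type_lattice [simp]: "vjoin type_lattice x y = sup x y"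
    and vmeet_type_lattice [simp]: "vmeet type_lattice x y = inf x y"
proof -
  have po: "partial_order ?L"
    by unfold_locales (auto simp: vorder_def)
  have lub: "least ?L (sup x y) (Upper ?L {x, y})" for x y
    by (auto simp: least_def Upper_def vorder_def)
  have glb: "greatest ?L (inf x y) (Lower ?L {x, y})" for x y
    by (auto simp: greatest_def Lower_def vorder_def)
  interpret partial_order ?L by (rule po)
  show "Lattice.lattice ?L"
    by unfold_locales (use lub glb in blast)+
  show "vjoin type_lattice x y = sup x y"
    unfolding vjoin_def join_def sup_def
    by (rule some_equality) (use lub least_unique in blast)+
  show "vmeet type_lattice x y = inf x y"
    unfolding vmeet_def meet_def inf_def
    by (rule some_equality) (use glb greatest_unique in blast)+
qed

lemma banach_lattice_on_type_lattice: "banach_lattice_on (type_lattice :: 'a::banach_lattice vlattice)"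
proof (rule banach_lattice_on.intro)
  show "Module.module real_ring (type_lattice :: 'a vlattice)"
    by (rule moduleI[OF cring_real_ring abelian_group_type_lattice])
       (auto simp: real_ring_def scaleR_add_left scaleR_add_right)
  show "Lattice.lattice (vorder (type_lattice :: 'a vlattice))"
    by (rule vorder_type_lattice)
next
  fix s :: "nat \<Rightarrow> 'a"
  assume "vCauchy type_lattice s"
  then have "Cauchy s"
    by (simp add: vCauchy_def Cauchy_def dist_norm)
  then obtain l where "s \<longlonglongrightarrow> l"
    using Cauchy_convergent convergent_def by blast
  then show "\<exists>l\<in>carrier type_lattice. vtendsto type_lattice s l"
    by (auto simp: vtendsto_def LIM_zero_iff tendsto_norm_zero_iff)
qed (auto simp: vabs_def scaleR_left_mono norm_mono_abs norm_triangle_ineq)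

definition lattice_hom ::
    "('a, 'm) vlattice_scheme \<Rightarrow> ('b, 'n) vlattice_scheme \<Rightarrow> ('a \<Rightarrow> 'b) \<Rightarrow> bool" where
  "lattice_hom X Y T \<longleftrightarrow>
     T \<in> carrier X \<rightarrow> carrier Y \<and>
     (\<forall>x\<in>carrier X. \<forall>y\<in>carrier X. T (x \<oplus>\<^bsub>X\<^esub> y) = T x \<oplus>\<^bsub>Y\<^esub> T y) \<and>
     (\<forall>a. \<forall>x\<in>carrier X. T (a \<odot>\<^bsub>X\<^esub> x) = a \<odot>\<^bsub>Y\<^esub> T x) \<and>
     (\<forall>x\<in>carrier X. \<forall>y\<in>carrier X. T (vjoin X x y) = vjoin Y (T x) (T y)) \<and>
     (\<forall>x\<in>carrier X. \<forall>y\<in>carrier X. T (vmeet X x y) = vmeet Y (T x) (T y)) \<and>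
     (\<exists>K. \<forall>x\<in>carrier X. vnorm Y (T x) \<le> K * vnorm X x)"

definition op_norm ::
    "('a, 'm) vlattice_scheme \<Rightarrow> ('b, 'n) vlattice_scheme \<Rightarrow> ('a \<Rightarrow> 'b) \<Rightarrow> real" where
  "op_norm X Y T = (SUP x\<in>{x \<in> carrier X. vnorm X x \<le> 1}. vnorm Y (T x))"

definition norm_closed :: "('b, 'm) vlattice_scheme \<Rightarrow> 'b set \<Rightarrow> bool" where
  "norm_closed Y S \<longleftrightarrow>
     (\<forall>s l. (\<forall>n. s n \<in> S) \<longrightarrow> l \<in> carrier Y \<longrightarrow> vtendsto Y s l \<longrightarrow> l \<in> S)"

definition closed_sublattice :: "('b, 'm) vlattice_scheme \<Rightarrow> 'b set \<Rightarrow> bool" where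
  "closed_sublattice Y S \<longleftrightarrow>
     submodule S real_ring Y \<and>
     (\<forall>x\<in>S. \<forall>y\<in>S. vjoin Y x y \<in> S \<and> vmeet Y x y \<in> S) \<and>
     norm_closed Y S"

definition closed_ideal :: "('b, 'm) vlattice_scheme \<Rightarrow> 'b set \<Rightarrow> bool" where
  "closed_ideal Y J \<longleftrightarrow>
     submodule J real_ring Y \<and>
     (\<forall>y\<in>J. \<forall>x\<in>carrier Y. vle Y (vabs Y x) (vabs Y y) \<longrightarrow> x \<in> J) \<and>
     norm_closed Y J"

text \<open>
  The quotient map sends \<open>y\<close> to the coset \<open>J +>\<^bsub>Y\<^esub> y\<close>.  Scalar multiplication is written as a union
  because the setwise product \<open>0 \<cdot> C\<close> is \<open>{0}\<close> and not the coset \<open>J\<close>.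
\<close>

definition quotient_lattice ::
    "('b, 'm) vlattice_scheme \<Rightarrow> 'b set \<Rightarrow> 'b set vlattice" where
  "quotient_lattice Y J =
     \<lparr>carrier = a_rcosets\<^bsub>Y\<^esub> J, mult = undefined, one = undefined, zero = J, add = set_add Y,
      smult = (\<lambda>a C. \<Union>x\<in>C. J +>\<^bsub>Y\<^esub> (a \<odot>\<^bsub>Y\<^esub> x)),
      vle = (\<lambda>C D. \<exists>x\<in>C. \<exists>y\<in>D. vle Y x y),
      vnorm = (\<lambda>C. INF x\<in>C. vnorm Y x)\<rparr>"


section \<open>Projectivity\<close>

text \<open>
  The type \<open>'y\<close> is the universe from which the elements of the Banach lattices \<open>Y\<close> are taken.
  Once \<open>'y\<close> has at least the cardinality of \<open>X\<close> and of the reals, the notion does not depend on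
  \<open>'y\<close> and is the unrestricted one: a given \<open>T\<close> into \<open>Y/J\<close> takes its values in the image of a
  closed sublattice \<open>Z\<close> of \<open>Y\<close> whose density character is at most that of \<open>X\<close> (or countable) and
  for which \<open>Z/(Z \<inter> J)\<close> embeds isometrically into \<open>Y/J\<close>.
\<close>

definition lambda_projective ::
    "'y itself \<Rightarrow> real \<Rightarrow> ('x, 'm) vlattice_scheme \<Rightarrow> bool" where
  "lambda_projective _ lam X \<longleftrightarrow>
     (\<forall>(Y :: 'y vlattice) J T.
        banach_lattice_on Y \<longrightarrow> closed_ideal Y J \<longrightarrow> lattice_hom X (quotient_lattice Y J) T \<longrightarrow>
        (\<exists>That. lattice_hom X Y That \<and>
           (\<forall>x\<in>carrier X. T x = J +>\<^bsub>Y\<^esub> That x) \<and>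
           op_norm X Y That \<le> lam * op_norm X (quotient_lattice Y J) T))"


section \<open>The free Banach lattice\<close>

text \<open>Functions on the dual space of \<open>'e\<close>.\<close>

type_synonym 'e dual_fun = "('e \<Rightarrow>\<^sub>L real) \<Rightarrow> real"

definition pos_homogeneous :: "'e::real_normed_vector dual_fun \<Rightarrow> bool" where
  "pos_homogeneous f \<longleftrightarrow> (\<forall>c>0. \<forall>\<phi>. f (c *\<^sub>R \<phi>) = c * f \<phi>)"

definition fbl_norm :: "'e::real_normed_vector dual_fun \<Rightarrow> ennreal" where
  "fbl_norm f =
     Sup {ennreal (\<Sum>i<n. \<bar>f (\<phi> i)\<bar>) | (n::nat) (\<phi> :: nat \<Rightarrow> 'e \<Rightarrow>\<^sub>L real).
          \<forall>x\<in>cball 0 1. (\<Sum>i<n. \<bar>blinfun_apply (\<phi> i) x\<bar>) \<le> 1}"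

definition H0 :: "'e::banach dual_fun vlattice" where
  "H0 = \<lparr>carrier = {f. pos_homogeneous f \<and> fbl_norm f < \<infinity>},
     mult = undefined, one = undefined,
     zero = (\<lambda>_. 0), add = (\<lambda>f g \<phi>. f \<phi> + g \<phi>), smult = (\<lambda>a f \<phi>. a * f \<phi>),
     vle = (\<le>), vnorm = (\<lambda>f. enn2real (fbl_norm f))\<rparr>"

definition fbl_delta :: "'e::banach \<Rightarrow> 'e dual_fun" where
  "fbl_delta x = (\<lambda>\<phi>. blinfun_apply \<phi> x)"

definition FBL :: "'e::banach dual_fun vlattice" where
  "FBL = H0\<lparr>carrier := \<Inter>{S. closed_sublattice H0 S \<and> range fbl_delta \<subseteq> S}\<rparr>"

text \<open>
  Extensionality fixes the values outside the carrier of \<^term>\<open>FBL\<close>, so that the description is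
  unique.
\<close>

definition fbl_beta :: "'a::banach_lattice dual_fun \<Rightarrow> 'a" where
  "fbl_beta = (THE b. b \<in> extensional (carrier FBL) \<and> lattice_hom FBL type_lattice b \<and>
     (\<forall>x. b (fbl_delta x) = x))"

definition lattice_lifting :: "'a::banach_lattice itself \<Rightarrow> real \<Rightarrow> bool" where
  "lattice_lifting _ lam \<longleftrightarrow>
     (\<exists>\<alpha> :: 'a \<Rightarrow> 'a dual_fun.
        lattice_hom type_lattice FBL \<alpha> \<and> op_norm type_lattice FBL \<alpha> \<le> lam \<and>
        (\<forall>x. fbl_beta (\<alpha> x) = x))"

end

theory Submission
  imports Defs "HOL-Library.Lattice_Algebras"
begin

text \<open>
  Let \<open>\<beta>\<close> be the canonical map from the free Banach lattice over \<open>X\<close> onto \<open>X\<close> and \<open>J\<close> its kernel.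
  Since \<open>\<beta>\<close> has the norm-one section \<open>\<delta>\<close>, the fibre map \<open>x \<mapsto> J + \<delta> x\<close> is a lattice homomorphism of
  norm at most one onto the quotient by \<open>J\<close>, and a lift of it provided by projectivity is a right
  inverse of \<open>\<beta>\<close>.

  The substance is the existence of \<open>\<beta>\<close>, that is, the inequality \<open>\<parallel>x\<parallel> \<le> \<parallel>f\<parallel>\<close> when \<open>f\<close> is a
  lattice-linear expression in evaluations and \<open>x\<close> is the same expression in elements of \<open>X\<close>.  For a
  positive functional \<open>\<phi>\<close> and \<open>w \<in> X\<close>, the Hahn--Banach theorem applied to \<open>y \<mapsto> \<phi> (y\<^sup>+)\<close> writes \<open>\<phi>\<close> as
  a sum of two positive functionals, each commuting with the positive part of \<open>w\<close>.  Iterating over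
  the finitely many joins in the expression decomposes a norming functional of \<open>\<bar>x\<bar>\<close> into positive
  functionals \<open>\<phi>\<^sub>i\<close> with \<open>f \<phi>\<^sub>i = \<phi>\<^sub>i x\<close>, whence \<open>\<parallel>x\<parallel> = (\<Sum>i. \<bar>f \<phi>\<^sub>i\<bar>) \<le> \<parallel>f\<parallel>\<close>.
\<close>

section \<open>The Hahn--Banach theorem\<close>

definition sublinear :: "('a::real_vector \<Rightarrow> real) \<Rightarrow> bool" where
  "sublinear p \<longleftrightarrow> (\<forall>x y. p (x + y) \<le> p x + p y) \<and> (\<forall>c\<ge>0. \<forall>x. p (c *\<^sub>R x) = c * p x)"

text \<open>Applying the scaling inequality with \<open>1 / c\<close> gives its reverse. For
  functions defined as infima only the inequality then has to be shown.\<close>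

lemma sublinearI:
  assumes add: "\<And>x y. p (x + y) \<le> p x + p y"
    and zero: "p 0 = 0"
    and scale: "\<And>c x. c > 0 \<Longrightarrow> p (c *\<^sub>R x) \<le> c * p x"
  shows "sublinear p"
  unfolding sublinear_def
proof (intro conjI allI impI)
  fix c :: real and x assume "c \<ge> 0"
  show "p (c *\<^sub>R x) = c * p x"
  proof (cases "c = 0")
    case False
    with \<open>c \<ge> 0\<close> have c: "c > 0" by simp
    have "p x = p ((1 / c) *\<^sub>R (c *\<^sub>R x))" using c by simp
    also have "\<dots> \<le> (1 / c) * p (c *\<^sub>R x)" using c by (intro scale) simp
    finally have "c * p x \<le> p (c *\<^sub>R x)" using c by (simp add: field_simps)
    with scale[OF c, of x] show ?thesis by simp
  qed (simp add: zero)
qed (rule add)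

lemma sublinearD:
  assumes "sublinear p"
  shows "p (x + y) \<le> p x + p y" and "c \<ge> 0 \<Longrightarrow> p (c *\<^sub>R x) = c * p x"
    and "p 0 = 0" and "- p (- x) \<le> p x"
proof -
  show add: "p (x + y) \<le> p x + p y" for x y
    using assms by (simp add: sublinear_def)
  show "c \<ge> 0 \<Longrightarrow> p (c *\<^sub>R x) = c * p x" for c x
    using assms by (simp add: sublinear_def)
  from this[of 0 0] show zero: "p 0 = 0" by simp
  show "- p (- x) \<le> p x" using add[of x "- x"] zero by simp
qed

text \<open>The function \<open>q\<close> below is the largest sublinear one under \<open>p\<close>
  whose value at \<open>- w\<close> is at most \<open>- p w\<close>. The result serves twice: to
  make a functional attain \<open>p\<close> at \<open>w\<close>, and to show that a minimal
  sublinear function is odd.\<close>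

lemma sublinear_tilt:
  assumes p: "sublinear p"
  obtains q where "sublinear q" "\<And>x. q x \<le> p x" "q (- w) \<le> - p w"
proof -
  define q where "q x = (INF t\<in>{0::real..}. p (x + t *\<^sub>R w) - t * p w)" for x
  note [simp] = sublinearD(2,3)[OF p]
  have "- p (- x) \<le> p (x + t *\<^sub>R w) - t * p w" if "t \<ge> 0" for x t
    using sublinearD(1)[OF p, of "x + t *\<^sub>R w" "- x"] that by simp
  then have bdd: "bdd_below ((\<lambda>t. p (x + t *\<^sub>R w) - t * p w) ` {0..})" for x
    by (intro bdd_belowI2) auto
  have le: "q x \<le> p (x + t *\<^sub>R w) - t * p w" if "t \<ge> 0" for x t
    unfolding q_def using bdd that by (intro cINF_lower) auto
  have ge: "m \<le> q x" if "\<And>t. t \<ge> 0 \<Longrightarrow> m \<le> p (x + t *\<^sub>R w) - t * p w" for m x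
    unfolding q_def using that by (intro cINF_greatest) auto
  show thesis
  proof
    show "sublinear q"
    proof (rule sublinearI)
      fix x y
      \<comment> \<open>The two infima are taken one after the other; the parameters
        \<open>s\<close> for \<open>x\<close> and \<open>t\<close> for \<open>y\<close> combine to
        \<open>s + t\<close> for \<open>x + y\<close>.\<close>
      have "q (x + y) - (p (y + t *\<^sub>R w) - t * p w) \<le> q x" if t: "t \<ge> 0" for t
      proof (rule ge)
        fix s :: real assume s: "s \<ge> 0"
        have "q (x + y) \<le> p ((x + s *\<^sub>R w) + (y + t *\<^sub>R w)) - (s + t) * p w"
          using le[of "s + t" "x + y"] s t by (simp add: algebra_simps)
        also have "\<dots> \<le> p (x + s *\<^sub>R w) + p (y + t *\<^sub>R w) - (s + t) * p w"
          using sublinearD(1)[OF p] by simp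
        finally show "q (x + y) - (p (y + t *\<^sub>R w) - t * p w) \<le> p (x + s *\<^sub>R w) - s * p w"
          by (simp add: algebra_simps)
      qed
      then have "q (x + y) - q x \<le> q y" by (intro ge) (simp add: algebra_simps)
      then show "q (x + y) \<le> q x + q y" by simp
    next
      show "q 0 = 0" using le[of 0 0] ge[of 0 0] by simp
    next
      fix c :: real and x assume c: "c > 0"
      have "q (c *\<^sub>R x) / c \<le> q x"
      proof (rule ge)
        fix t :: real assume t: "t \<ge> 0"
        have "q (c *\<^sub>R x) \<le> p (c *\<^sub>R (x + t *\<^sub>R w)) - (c * t) * p w"
          using le[of "c * t" "c *\<^sub>R x"] c t by (simp only: scaleR_add_right scaleR_scaleR) simp
        also have "\<dots> = c * (p (x + t *\<^sub>R w) - t * p w)"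
          using c by (simp add: right_diff_distrib)
        finally show "q (c *\<^sub>R x) / c \<le> p (x + t *\<^sub>R w) - t * p w"
          using c by (simp add: field_simps)
      qed
      then show "q (c *\<^sub>R x) \<le> c * q x" using c by (simp add: field_simps)
    qed
    show "q x \<le> p x" for x using le[of 0 x] by simp
    show "q (- w) \<le> - p w" using le[of 1 "- w"] by simp
  qed
qed

text \<open>Zorn's lemma for the reversed pointwise order. The pointwise infimum of a chain is
  finite because every sublinear \<open>q\<close> below \<open>p\<close> satisfies
  \<open>- p (- x) \<le> q x\<close>.\<close>

lemma minimal_sublinear:
  fixes p :: "'a::real_vector \<Rightarrow> real"
  assumes p: "sublinear p"
  obtains q where "sublinear q" "\<And>x. q x \<le> p x"
    "\<And>r. sublinear r \<Longrightarrow> (\<And>x. r x \<le> q x) \<Longrightarrow> r = q"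
proof -
  define A where "A = {q. sublinear q \<and> q \<le> p}"
  let ?P = "\<lambda>q r :: 'a \<Rightarrow> real. r \<le> q"
  have "\<exists>m\<in>A. \<forall>a\<in>A. ?P m a \<longrightarrow> a = m"
  proof (rule predicate_Zorn)
    show "partial_order_on A (relation_of ?P A)"
      by (rule partial_order_on_relation_ofI) auto
  next
    fix C assume "C \<in> Chains (relation_of ?P A)"
    then have CA: "C \<subseteq> A" and chain: "\<And>q r. q \<in> C \<Longrightarrow> r \<in> C \<Longrightarrow> q \<le> r \<or> r \<le> q"
      unfolding Chains_def relation_of_def by blast+
    show "\<exists>u\<in>A. \<forall>a\<in>C. ?P a u"
    proof (cases "C = {}")
      case True
      then show ?thesis using p by (auto simp: A_def)
    next
      case False
      have sub: "sublinear q" and le_p: "q x \<le> p x" if "q \<in> C" for q x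
        using CA that by (auto simp: A_def le_fun_def)
      define u where "u x = (INF q\<in>C. q x)" for x
      have "- p (- x) \<le> q x" if "q \<in> C" for q x
        using sublinearD(4)[OF sub[OF that], of x] le_p[OF that, of "- x"] by simp
      then have "bdd_below ((\<lambda>q. q x) ` C)" for x
        by (intro bdd_belowI2) auto
      then have le: "u x \<le> q x" if "q \<in> C" for q x
        unfolding u_def using that by (intro cINF_lower) auto
      have ge: "m \<le> u x" if "\<And>q. q \<in> C \<Longrightarrow> m \<le> q x" for m x
        unfolding u_def using that False by (intro cINF_greatest) auto
      have "sublinear u"
      proof (rule sublinearI)
        fix x y
        have "u (x + y) - r y \<le> u x" if r: "r \<in> C" for r
        proof (rule ge)
          fix q assume q: "q \<in> C"
          \<comment> \<open>Different members \<open>q\<close> and \<open>r\<close> bound the two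
            values; the smaller of them serves for both. This is where the chain property makes the
            infimum subadditive.\<close>
          from chain[OF q r] obtain s where s: "s \<in> C" "s \<le> q" "s \<le> r"
            using q r by blast
          have "u (x + y) \<le> s x + s y"
            using le[OF s(1)] sublinearD(1)[OF sub[OF s(1)]] order_trans by blast
          also have "\<dots> \<le> q x + r y" using s(2,3) by (intro add_mono) (auto simp: le_fun_def)
          finally show "u (x + y) - r y \<le> q x" by simp
        qed
        then have "u (x + y) - u x \<le> u y" by (intro ge) (simp add: algebra_simps)
        then show "u (x + y) \<le> u x + u y" by simp
      next
        from False obtain q where q: "q \<in> C" by blast
        have "0 \<le> u 0" by (rule ge) (simp add: sublinearD(3)[OF sub])
        with le[OF q, of 0] show "u 0 = 0" by (simp add: sublinearD(3)[OF sub[OF q]])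
      next
        fix c :: real and x assume c: "c > 0"
        have "u (c *\<^sub>R x) / c \<le> u x"
        proof (rule ge)
          fix q assume "q \<in> C"
          then show "u (c *\<^sub>R x) / c \<le> q x"
            using le[of q "c *\<^sub>R x"] c sublinearD(2)[OF sub, of q c x] by (simp add: field_simps)
        qed
        then show "u (c *\<^sub>R x) \<le> c * u x" using c by (simp add: field_simps)
      qed
      moreover have "u \<le> p"
        unfolding le_fun_def using False le le_p order_trans by blast
      ultimately show ?thesis using le by (auto simp: A_def le_fun_def)
    qed
  qed
  then obtain q where q: "sublinear q" "q \<le> p" and min: "\<And>r. r \<in> A \<Longrightarrow> r \<le> q \<Longrightarrow> r = q"
    unfolding A_def by blast
  show thesis
  proof
    show "r = q" if "sublinear r" "\<And>x. r x \<le> q x" for r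
    proof (rule min)
      show "r \<le> q" using that(2) by (rule le_funI)
      with that(1) q(2) show "r \<in> A" by (simp add: A_def)
    qed
  qed (use q in \<open>auto simp: le_fun_def\<close>)
qed

text \<open>Take a minimal sublinear function below the tilt of \<open>p\<close> at
  \<open>w\<close>. Tilting it at any \<open>x\<close> cannot lower it, which forces it to be odd,
  and an odd sublinear function is linear. Oddness turns the bound at \<open>- w\<close> into
  attainment at \<open>w\<close>.\<close>

lemma hahn_banach_attained:
  assumes p: "sublinear p"
  obtains \<phi> where "linear \<phi>" "\<And>x. \<phi> x \<le> p x" "\<phi> w = p w"
proof -
  obtain p' where p': "sublinear p'" "\<And>x. p' x \<le> p x" "p' (- w) \<le> - p w"
    using sublinear_tilt[OF p, of w] by blast
  obtain \<phi> where \<phi>: "sublinear \<phi>" "\<And>x. \<phi> x \<le> p' x"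
    and minimal: "\<And>r. sublinear r \<Longrightarrow> (\<And>x. r x \<le> \<phi> x) \<Longrightarrow> r = \<phi>"
    using minimal_sublinear[OF p'(1)] by blast
  have odd: "\<phi> (- x) = - \<phi> x" for x
  proof -
    obtain r where "sublinear r" "\<And>y. r y \<le> \<phi> y" "r (- x) \<le> - \<phi> x"
      using sublinear_tilt[OF \<phi>(1), of x] by blast
    with minimal[of r] have "\<phi> (- x) \<le> - \<phi> x" by simp
    with sublinearD(4)[OF \<phi>(1), of x] show ?thesis by simp
  qed
  note \<phi>_add = sublinearD(1)[OF \<phi>(1)] and \<phi>_scale = sublinearD(2)[OF \<phi>(1)]
  have "linear \<phi>"
  proof (rule linearI)
    fix x y
    have "\<phi> x \<le> \<phi> (x + y) + \<phi> (- y)" using \<phi>_add[of "x + y" "- y"] by simp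
    then show "\<phi> (x + y) = \<phi> x + \<phi> y" using \<phi>_add[of x y] by (simp add: odd)
  next
    fix c :: real and x
    show "\<phi> (c *\<^sub>R x) = c *\<^sub>R \<phi> x"
    proof (cases "c \<ge> 0")
      case False
      then have "\<phi> ((- c) *\<^sub>R x) = - c * \<phi> x" by (intro \<phi>_scale) simp
      then show ?thesis by (simp add: odd)
    qed (simp add: \<phi>_scale)
  qed
  moreover have "\<phi> x \<le> p x" for x using \<phi>(2) p'(2) order_trans by blast
  moreover have "\<phi> w = p w"
    using \<phi>(2)[of "- w"] p'(3) odd[of w] calculation(2)[of w] by simp
  ultimately show thesis by (rule that)
qed

section \<open>Positive functionals on a Banach lattice\<close>

text \<open>Makes the positive part \<open>pprt\<close> and the identities of lattice-ordered groups
  available.\<close>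

instance banach_lattice \<subseteq> lattice_ab_group_add ..

lemma scaleR_sup_distrib:
  fixes x y :: "'a::banach_lattice"
  assumes "c \<ge> 0"
  shows "c *\<^sub>R sup x y = sup (c *\<^sub>R x) (c *\<^sub>R y)"
proof (cases "c = 0")
  case False
  with assms have c: "c > 0" by simp
  show ?thesis
  proof (rule antisym)
    have "sup x y \<le> (1 / c) *\<^sub>R sup (c *\<^sub>R x) (c *\<^sub>R y)"
      using scaleR_left_mono[of "c *\<^sub>R x" "sup (c *\<^sub>R x) (c *\<^sub>R y)" "1 / c"]
        scaleR_left_mono[of "c *\<^sub>R y" "sup (c *\<^sub>R x) (c *\<^sub>R y)" "1 / c"] c
      by simp
    from scaleR_left_mono[OF this assms] show "c *\<^sub>R sup x y \<le> sup (c *\<^sub>R x) (c *\<^sub>R y)"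
      using c by simp
  qed (use assms in \<open>simp add: scaleR_left_mono\<close>)
qed simp

lemma pprt_add_le:
  fixes x y :: "'a::banach_lattice"
  shows "pprt (x + y) \<le> pprt x + pprt y"
  unfolding pprt_def by (rule sup_least) (auto intro: add_mono)

lemma pprt_scaleR:
  fixes x :: "'a::banach_lattice"
  shows "c \<ge> 0 \<Longrightarrow> pprt (c *\<^sub>R x) = c *\<^sub>R pprt x"
  by (simp add: pprt_def scaleR_sup_distrib)

lemma sup_uminus_nonneg:
  fixes x :: "'a::banach_lattice"
  shows "0 \<le> sup x (- x)"
proof -
  have "0 \<le> sup x (- x) + sup x (- x)"
    using add_mono[of x "sup x (- x)" "- x" "sup x (- x)"] by simp
  then show ?thesis
    using scaleR_left_mono[of 0 "2 *\<^sub>R sup x (- x)" "1 / 2"] by (simp add: scaleR_2)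
qed

lemma uminus_le_self:
  fixes x :: "'a::ordered_ab_group_add"
  shows "0 \<le> x \<Longrightarrow> - x \<le> x"
  using neg_le_0_iff_le order_trans by blast

lemma norm_mono:
  fixes x y :: "'a::banach_lattice"
  assumes "0 \<le> x" "x \<le> y"
  shows "norm x \<le> norm y"
proof (rule norm_mono_abs)
  have "0 \<le> y" using assms by (rule order_trans)
  then have "- x \<le> x" "- y \<le> y" using assms(1) by (simp_all add: uminus_le_self)
  then show "sup x (- x) \<le> sup y (- y)" using assms by (simp add: sup_absorb1)
qed

lemma norm_abs:
  fixes x :: "'a::banach_lattice"
  shows "norm (sup x (- x)) = norm x"
proof -
  have "- sup x (- x) \<le> sup x (- x)"
    using sup_uminus_nonneg[of x] by (rule uminus_le_self)
  then have "sup (sup x (- x)) (- sup x (- x)) = sup x (- x)" by (rule sup_absorb1)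
  then show ?thesis by (intro antisym norm_mono_abs) auto
qed

lemma norm_pprt_le:
  fixes x :: "'a::banach_lattice"
  shows "norm (pprt x) \<le> norm x"
proof -
  have "pprt x \<le> sup x (- x)" unfolding pprt_def using sup_uminus_nonneg by simp
  from norm_mono[OF zero_le_pprt this] show ?thesis by (simp add: norm_abs)
qed

section \<open>Positive functionals obtained from sublinear majorants\<close>

definition pos_functional :: "('a::banach_lattice \<Rightarrow>\<^sub>L real) \<Rightarrow> bool" where
  "pos_functional \<phi> \<longleftrightarrow> (\<forall>x\<ge>0. 0 \<le> blinfun_apply \<phi> x)"

lemma pos_functional_mono: "pos_functional \<phi> \<Longrightarrow> x \<le> y \<Longrightarrow> blinfun_apply \<phi> x \<le> blinfun_apply \<phi> y"
  unfolding pos_functional_def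
  by (metis blinfun.diff_right diff_ge_0_iff_ge)

lemma pos_functional_add: "pos_functional \<phi> \<Longrightarrow> pos_functional \<psi> \<Longrightarrow> pos_functional (\<phi> + \<psi>)"
  by (simp add: pos_functional_def blinfun.add_left)

lemma pos_functional_abs_le:
  assumes "pos_functional \<phi>"
  shows "\<bar>blinfun_apply \<phi> x\<bar> \<le> blinfun_apply \<phi> (sup x (- x))"
  using pos_functional_mono[OF assms, of x "sup x (- x)"]
    pos_functional_mono[OF assms, of "- x" "sup x (- x)"]
  by (simp add: blinfun.minus_right)

text \<open>The positive part in the one-sided bound yields positivity: for \<open>x \<ge> 0\<close>
  the positive part of \<open>- x\<close> is 0, hence \<open>\<phi> (- x) \<le> 0\<close>. Used at
  both \<open>x\<close> and \<open>- x\<close>, the bound yields continuity.\<close>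

lemma linear_pprt_bound_imp_functional:
  fixes \<phi> :: "'a::banach_lattice \<Rightarrow> real"
  assumes lin: "linear \<phi>" and le: "\<And>x. \<phi> x \<le> K * norm (pprt x)"
  obtains \<psi> where "pos_functional \<psi>" "\<And>x. blinfun_apply \<psi> x = \<phi> x"
proof -
  have K: "K * norm (pprt x) \<le> \<bar>K\<bar> * norm x" for x :: 'a
    by (intro mult_mono norm_pprt_le) auto
  have "bounded_linear \<phi>"
  proof (rule bounded_linear_intro)
    fix x
    show "norm (\<phi> x) \<le> norm x * \<bar>K\<bar>"
      using order_trans[OF le[of x] K] order_trans[OF le[of "- x"] K] linear_neg[OF lin, of x]
      by (auto simp: mult.commute)
  qed (use lin in \<open>simp_all add: linear_add linear_scale\<close>)
  then have app: "blinfun_apply (Blinfun \<phi>) x = \<phi> x" for x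
    by (simp add: bounded_linear_Blinfun_apply)
  have "0 \<le> \<phi> x" if "0 \<le> x" for x
    using le[of "- x"] that linear_neg[OF lin, of x] by simp
  then show thesis by (intro that[of "Blinfun \<phi>"]) (simp_all add: app pos_functional_def)
qed

text \<open>The Hahn-Banach theorem is applied to \<open>norm (pprt y)\<close> instead of
  \<open>norm y\<close>, so that the functional attaining the majorant at \<open>sup x (- x)\<close>
  is positive.\<close>

lemma norming_pos_functional:
  fixes x :: "'a::banach_lattice"
  obtains \<phi> where "pos_functional \<phi>" "\<And>y. blinfun_apply \<phi> y \<le> norm y"
    "blinfun_apply \<phi> (sup x (- x)) = norm x"
proof -
  have sub: "sublinear (\<lambda>y::'a. norm (pprt y))"
  proof (rule sublinearI)
    fix y z :: 'a
    have "norm (pprt (y + z)) \<le> norm (pprt y + pprt z)"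
      by (rule norm_mono[OF zero_le_pprt pprt_add_le])
    then show "norm (pprt (y + z)) \<le> norm (pprt y) + norm (pprt z)"
      using norm_triangle_ineq order_trans by blast
  qed (simp_all add: pprt_scaleR)
  obtain f where f: "linear f" "\<And>y. f y \<le> norm (pprt y)"
    and eq: "f (sup x (- x)) = norm (pprt (sup x (- x)))"
    using hahn_banach_attained[OF sub, of "sup x (- x)"] by blast
  obtain \<phi> where \<phi>: "pos_functional \<phi>" "\<And>x. blinfun_apply \<phi> x = f x"
    using linear_pprt_bound_imp_functional[OF f(1), of 1] f(2) by auto
  show thesis
  proof
    show "blinfun_apply \<phi> y \<le> norm y" for y
      using f(2)[of y] norm_pprt_le[of y] by (simp add: \<phi>(2))
    show "blinfun_apply \<phi> (sup x (- x)) = norm x"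
      using eq by (simp add: \<phi>(2) sup_uminus_nonneg norm_abs)
  qed (rule \<phi>(1))
qed

text \<open>
  Lattice homomorphisms into the reals may not exist; positive functionals that behave like one
  on finitely many prescribed elements always do.
\<close>

definition splits :: "('a::banach_lattice \<Rightarrow>\<^sub>L real) \<Rightarrow> 'a \<Rightarrow> bool" where
  "splits \<phi> w \<longleftrightarrow> blinfun_apply \<phi> (pprt w) = max (blinfun_apply \<phi> w) 0"

text \<open>A join is one positive part up to a translation, so one splitting condition per join is
  enough.\<close>

lemma splits_sup:
  assumes "splits \<phi> (x - y)"
  shows "blinfun_apply \<phi> (sup x y) = max (blinfun_apply \<phi> x) (blinfun_apply \<phi> y)"
proof -
  have "sup x y = y + pprt (x - y)"
    by (simp add: pprt_def add_sup_distrib_left)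
  then show ?thesis
    using assms by (simp add: splits_def blinfun.add_right blinfun.diff_right)
qed

text \<open>Splitting \<open>w\<close> means that \<open>\<phi>\<close> vanishes on
  \<open>pprt w\<close>, or on \<open>pprt w - w\<close> with a nonnegative value at
  \<open>w\<close>. Both elements are positive, so a positive functional dominated by
  \<open>\<phi>\<close> vanishes wherever \<open>\<phi>\<close> does.\<close>

lemma splits_antimono:
  assumes "splits \<phi> w" "pos_functional \<psi>" "pos_functional (\<phi> - \<psi>)"
  shows "splits \<psi> w"
proof -
  have le: "0 \<le> blinfun_apply \<psi> x" "blinfun_apply \<psi> x \<le> blinfun_apply \<phi> x" if "0 \<le> x" for x
    using assms(2,3) that by (simp_all add: pos_functional_def blinfun.diff_left)
  have "w \<le> pprt w" by (simp add: pprt_def)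
  then have ge: "blinfun_apply \<psi> w \<le> blinfun_apply \<psi> (pprt w)"
    by (rule pos_functional_mono[OF assms(2)])
  show ?thesis
  proof (cases "blinfun_apply \<phi> (pprt w) = 0")
    case True
    with le[of "pprt w"] ge show ?thesis by (simp add: splits_def)
  next
    case False
    with assms(1) have "blinfun_apply \<phi> (pprt w - w) = 0"
      by (auto simp: splits_def blinfun.diff_right max_def split: if_splits)
    with le[of "pprt w - w"] \<open>w \<le> pprt w\<close> have "blinfun_apply \<psi> (pprt w) = blinfun_apply \<psi> w"
      by (simp add: blinfun.diff_right)
    with le[of "pprt w"] show ?thesis by (simp add: splits_def)
  qed
qed

text \<open>The functional \<open>\<phi>1\<close> carries the part of \<open>\<phi>\<close> living
  on the positive part of \<open>w\<close>: it vanishes on \<open>pprt w - w\<close>, while the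
  remainder vanishes on \<open>pprt w\<close>. Each vanishing settles one of the two cases of the
  maximum.\<close>

lemma pos_functional_split:
  assumes \<phi>: "pos_functional \<phi>"
  obtains \<phi>1 \<phi>2 where "pos_functional \<phi>1" "pos_functional \<phi>2" "\<phi> = \<phi>1 + \<phi>2"
    "splits \<phi>1 w" "splits \<phi>2 w"
proof -
  have sub: "sublinear (\<lambda>x. blinfun_apply \<phi> (pprt x))"
  proof (rule sublinearI)
    fix x y
    show "blinfun_apply \<phi> (pprt (x + y)) \<le> blinfun_apply \<phi> (pprt x) + blinfun_apply \<phi> (pprt y)"
      using pos_functional_mono[OF \<phi> pprt_add_le[of x y]] by (simp add: blinfun.add_right)
  qed (simp_all add: pprt_scaleR blinfun.scaleR_right)
  obtain f where f: "linear f" "\<And>x. f x \<le> blinfun_apply \<phi> (pprt x)"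
    and fw: "f w = blinfun_apply \<phi> (pprt w)"
    using hahn_banach_attained[OF sub, of w] by blast
  have "f x \<le> norm \<phi> * norm (pprt x)" for x
    using f(2)[of x] norm_blinfun[of \<phi> "pprt x"] by simp
  then obtain \<phi>1 where \<phi>1: "pos_functional \<phi>1" "\<And>x. blinfun_apply \<phi>1 x = f x"
    using linear_pprt_bound_imp_functional[OF f(1)] by blast
  have \<phi>2: "pos_functional (\<phi> - \<phi>1)"
    unfolding pos_functional_def blinfun.diff_left \<phi>1(2) using f(2) by (metis pprt_eq_id diff_ge_0_iff_ge)
  have "w \<le> pprt w" by (simp add: pprt_def)
  \<comment> \<open>A squeeze: \<open>\<phi> (pprt w) = \<phi>1 w \<le> \<phi>1 (pprt w) \<le>
    \<phi> (pprt w)\<close>, with attainment at \<open>w\<close> on the left and the majorant at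
    \<open>pprt w\<close> on the right.\<close>
  have eq: "blinfun_apply \<phi>1 (pprt w) = blinfun_apply \<phi> (pprt w)"
    "blinfun_apply \<phi>1 w = blinfun_apply \<phi> (pprt w)"
    using \<phi>1(2) fw f(2)[of "pprt w"] pos_functional_mono[OF \<phi>1(1) \<open>w \<le> pprt w\<close>] by simp_all
  show thesis
  proof
    show "splits \<phi>1 w"
      using \<phi>1(1) eq by (simp add: splits_def) (metis pos_functional_def zero_le_pprt max_absorb1)
    have "blinfun_apply (\<phi> - \<phi>1) (pprt w) = 0" by (simp add: blinfun.diff_left eq)
    with pos_functional_mono[OF \<phi>2 \<open>w \<le> pprt w\<close>] show "splits (\<phi> - \<phi>1) w"
      by (simp add: splits_def)
  qed (use \<phi>1(1) \<phi>2 in auto)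
qed

text \<open>Split at the new element first, then decompose both halves for the remaining ones. That
  each piece is dominated by the original functional is part of the claim because it lets the pieces
  inherit the splitting of the new element.\<close>

lemma pos_functional_split_finite:
  assumes "finite W" "pos_functional \<phi>"
  shows "\<exists>\<psi>s. \<phi> = sum_list \<psi>s \<and> (\<forall>\<psi>\<in>set \<psi>s. pos_functional \<psi> \<and> pos_functional (\<phi> - \<psi>) \<and> (\<forall>w\<in>W. splits \<psi> w))"
  using assms
proof (induction W arbitrary: \<phi> rule: finite_induct)
  case empty
  then show ?case by (intro exI[of _ "[\<phi>]"]) (simp add: pos_functional_def)
next
  case (insert w W)
  obtain \<phi>1 \<phi>2 where pos: "pos_functional \<phi>1" "pos_functional \<phi>2" and \<phi>: "\<phi> = \<phi>1 + \<phi>2"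
    and splits: "splits \<phi>1 w" "splits \<phi>2 w"
    by (rule pos_functional_split[OF insert.prems])
  obtain L1 where L1: "\<phi>1 = sum_list L1" "\<forall>\<psi>\<in>set L1. pos_functional \<psi> \<and> pos_functional (\<phi>1 - \<psi>) \<and> (\<forall>w\<in>W. splits \<psi> w)"
    using insert.IH[OF pos(1)] by blast
  obtain L2 where L2: "\<phi>2 = sum_list L2" "\<forall>\<psi>\<in>set L2. pos_functional \<psi> \<and> pos_functional (\<phi>2 - \<psi>) \<and> (\<forall>w\<in>W. splits \<psi> w)"
    using insert.IH[OF pos(2)] by blast
  have "pos_functional (\<phi> - \<psi>)" if "\<psi> \<in> set L1" for \<psi>
    using pos_functional_add[OF _ pos(2), of "\<phi>1 - \<psi>"] L1(2) that by (simp add: \<phi> algebra_simps)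
  moreover have "pos_functional (\<phi> - \<psi>)" if "\<psi> \<in> set L2" for \<psi>
    using pos_functional_add[OF pos(1), of "\<phi>2 - \<psi>"] L2(2) that by (simp add: \<phi> algebra_simps)
  moreover have "splits \<psi> w" if "\<psi> \<in> set L1 \<union> set L2" for \<psi>
    using that splits L1(2) L2(2) splits_antimono by blast
  ultimately show ?case
    using L1 L2 by (intro exI[of _ "L1 @ L2"]) (auto simp: \<phi>)
qed

section \<open>The ambient lattice of the free Banach lattice and its sublattices\<close>

text \<open>The conversion sends infinity to 0, so this is the free norm only on the carrier of
  \<open>H0\<close>; estimates therefore come with membership in that carrier.\<close>

definition fnorm :: "'e::real_normed_vector dual_fun \<Rightarrow> real" where
  "fnorm f = enn2real (fbl_norm f)"

definition admissible :: "nat \<Rightarrow> (nat \<Rightarrow> 'e::real_normed_vector \<Rightarrow>\<^sub>L real) \<Rightarrow> bool" where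
  "admissible n \<phi> \<longleftrightarrow> (\<forall>x\<in>cball 0 1. (\<Sum>i<n. \<bar>blinfun_apply (\<phi> i) x\<bar>) \<le> 1)"

lemma H0_simps [simp]:
  "\<zero>\<^bsub>H0\<^esub> = (\<lambda>_. 0)" "f \<oplus>\<^bsub>H0\<^esub> g = (\<lambda>\<phi>. f \<phi> + g \<phi>)" "a \<odot>\<^bsub>H0\<^esub> f = (\<lambda>\<phi>. a * f \<phi>)"
  "vle H0 f g \<longleftrightarrow> f \<le> g" "vnorm H0 f = fnorm f"
  by (simp_all add: H0_def fnorm_def)

lemma H0I:
  assumes "pos_homogeneous f" and le: "\<And>n \<phi>. admissible n \<phi> \<Longrightarrow> (\<Sum>i<n. \<bar>f (\<phi> i)\<bar>) \<le> K"
  shows "f \<in> carrier H0" and "fnorm f \<le> K"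
proof -
  \<comment> \<open>The empty family is admissible and its sum is 0.\<close>
  have K: "0 \<le> K" using le[of 0] by (simp add: admissible_def)
  have norm_le: "fbl_norm f \<le> ennreal K"
    unfolding fbl_norm_def
    by (rule Sup_least) (use le in \<open>auto simp: admissible_def intro!: ennreal_leI\<close>)
  show "fnorm f \<le> K"
    unfolding fnorm_def using K norm_le by (rule enn2real_leI)
  have "fbl_norm f < \<infinity>" using norm_le by (rule le_less_trans) simp
  then show "f \<in> carrier H0" using assms(1) by (simp add: H0_def)
qed

lemma H0_pos_homogeneous: "f \<in> carrier H0 \<Longrightarrow> pos_homogeneous f"
  by (simp add: H0_def)

lemma sum_le_fnorm:
  assumes "f \<in> carrier H0" "admissible n \<phi>"
  shows "(\<Sum>i<n. \<bar>f (\<phi> i)\<bar>) \<le> fnorm f"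
proof -
  have "ennreal (\<Sum>i<n. \<bar>f (\<phi> i)\<bar>) \<le> fbl_norm f"
    unfolding fbl_norm_def using assms(2) by (intro Sup_upper) (auto simp: admissible_def)
  moreover have "fbl_norm f < \<infinity>" using assms(1) by (simp add: H0_def)
  ultimately show ?thesis
    unfolding fnorm_def using enn2real_mono[of "ennreal (\<Sum>i<n. \<bar>f (\<phi> i)\<bar>)" "fbl_norm f"]
    by (simp add: sum_nonneg)
qed

lemma fnorm_nonneg: "0 \<le> fnorm f"
  by (simp add: fnorm_def)

text \<open>The pointwise bound is summed over each admissible family. Closure under sums and
  maxima, monotonicity of the norm and all difference estimates are instances of this.\<close>

lemma H0_dominated:
  assumes f: "f \<in> carrier H0" and g: "g \<in> carrier H0" and h: "pos_homogeneous h"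
    and le: "\<And>\<phi>. \<bar>h \<phi>\<bar> \<le> \<bar>f \<phi>\<bar> + \<bar>g \<phi>\<bar>"
  shows "h \<in> carrier H0" and "fnorm h \<le> fnorm f + fnorm g"
proof -
  have "(\<Sum>i<n. \<bar>h (\<phi> i)\<bar>) \<le> fnorm f + fnorm g" if "admissible n \<phi>" for n and \<phi> :: "nat \<Rightarrow> 'a \<Rightarrow>\<^sub>L real"
  proof -
    have "(\<Sum>i<n. \<bar>h (\<phi> i)\<bar>) \<le> (\<Sum>i<n. \<bar>f (\<phi> i)\<bar>) + (\<Sum>i<n. \<bar>g (\<phi> i)\<bar>)"
      unfolding sum.distrib[symmetric] by (intro sum_mono le)
    also have "\<dots> \<le> fnorm f + fnorm g"
      by (intro add_mono sum_le_fnorm f g that)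
    finally show ?thesis .
  qed
  from H0I[OF h this] show "h \<in> carrier H0" "fnorm h \<le> fnorm f + fnorm g" by auto
qed

lemma zero_H0: "(\<lambda>_. 0) \<in> carrier (H0 :: 'e::banach dual_fun vlattice)"
  and fnorm_zero: "fnorm (\<lambda>_ :: 'e \<Rightarrow>\<^sub>L real. 0) = 0"
proof -
  have "pos_homogeneous (\<lambda>_ :: 'e \<Rightarrow>\<^sub>L real. 0)" by (simp add: pos_homogeneous_def)
  from H0I[OF this, of 0]
  show "(\<lambda>_. 0) \<in> carrier (H0 :: 'e dual_fun vlattice)" "fnorm (\<lambda>_ :: 'e \<Rightarrow>\<^sub>L real. 0) = 0"
    by (simp_all add: order.antisym[OF _ fnorm_nonneg])
qed

lemma fnorm_mono:
  assumes "f \<in> carrier H0" "h \<in> carrier H0" "\<And>\<phi>. \<bar>h \<phi>\<bar> \<le> \<bar>f \<phi>\<bar>"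
  shows "fnorm h \<le> fnorm f"
  using H0_dominated(2)[OF assms(1) zero_H0 H0_pos_homogeneous[OF assms(2)]] assms(3)
  by (simp add: fnorm_zero)

lemma add_H0:
  assumes "f \<in> carrier H0" "g \<in> carrier H0"
  shows "(\<lambda>\<phi>. f \<phi> + g \<phi>) \<in> carrier H0" and "fnorm (\<lambda>\<phi>. f \<phi> + g \<phi>) \<le> fnorm f + fnorm g"
proof -
  have "pos_homogeneous (\<lambda>\<phi>. f \<phi> + g \<phi>)"
    using assms[THEN H0_pos_homogeneous] by (simp add: pos_homogeneous_def distrib_left)
  from H0_dominated[OF assms this abs_triangle_ineq]
  show "(\<lambda>\<phi>. f \<phi> + g \<phi>) \<in> carrier H0" "fnorm (\<lambda>\<phi>. f \<phi> + g \<phi>) \<le> fnorm f + fnorm g" .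
qed

lemma scale_H0:
  assumes f: "f \<in> carrier H0"
  shows "(\<lambda>\<phi>. c * f \<phi>) \<in> carrier H0" and "fnorm (\<lambda>\<phi>. c * f \<phi>) = \<bar>c\<bar> * fnorm f"
proof -
  have scale: "(\<lambda>\<phi>. c * g \<phi>) \<in> carrier H0 \<and> fnorm (\<lambda>\<phi>. c * g \<phi>) \<le> \<bar>c\<bar> * fnorm g"
    if g: "g \<in> carrier H0" for c and g :: "'a dual_fun"
  proof -
    have "pos_homogeneous (\<lambda>\<phi>. c * g \<phi>)"
      using g[THEN H0_pos_homogeneous] by (simp add: pos_homogeneous_def)
    moreover have "(\<Sum>i<n. \<bar>c * g (\<phi> i)\<bar>) \<le> \<bar>c\<bar> * fnorm g"
      if "admissible n \<phi>" for n and \<phi> :: "nat \<Rightarrow> 'a \<Rightarrow>\<^sub>L real"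
      using mult_left_mono[OF sum_le_fnorm[OF g that], of "\<bar>c\<bar>"]
      by (simp add: abs_mult sum_distrib_left)
    ultimately show ?thesis using H0I by blast
  qed
  then show "(\<lambda>\<phi>. c * f \<phi>) \<in> carrier H0" using f by blast
  show "fnorm (\<lambda>\<phi>. c * f \<phi>) = \<bar>c\<bar> * fnorm f"
  proof (cases "c = 0")
    case False
    \<comment> \<open>The inequality already shown, applied with \<open>1 / c\<close>, gives the
      reverse estimate.\<close>
    then have "fnorm f = fnorm (\<lambda>\<phi>. (1 / c) * (c * f \<phi>))" by simp
    also have "\<dots> \<le> \<bar>1 / c\<bar> * fnorm (\<lambda>\<phi>. c * f \<phi>)" using scale f by blast
    finally have "\<bar>c\<bar> * fnorm f \<le> fnorm (\<lambda>\<phi>. c * f \<phi>)"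
      using False by (simp add: field_simps)
    with scale[OF f, of c] show ?thesis by simp
  qed (simp add: fnorm_zero)
qed

lemma diff_H0:
  assumes "f \<in> carrier H0" "g \<in> carrier H0"
  shows "f - g \<in> carrier H0"
  using add_H0(1)[OF assms(1) scale_H0(1)[OF assms(2), of "-1"]] by (simp add: fun_diff_def)

lemma max_H0:
  assumes "f \<in> carrier H0" "g \<in> carrier H0"
  shows "(\<lambda>\<phi>. max (f \<phi>) (g \<phi>)) \<in> carrier H0"
proof -
  have "pos_homogeneous (\<lambda>\<phi>. max (f \<phi>) (g \<phi>))"
    using assms[THEN H0_pos_homogeneous] by (simp add: pos_homogeneous_def max_mult_distrib_left)
  from H0_dominated(1)[OF assms this] show ?thesis by (auto simp: max_def)
qed

lemma fnorm_max_diff: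
  assumes "f \<in> carrier H0" "g \<in> carrier H0" "f' \<in> carrier H0" "g' \<in> carrier H0"
  shows "fnorm ((\<lambda>\<phi>. max (f \<phi>) (g \<phi>)) - (\<lambda>\<phi>. max (f' \<phi>) (g' \<phi>))) \<le> fnorm (f - f') + fnorm (g - g')"
proof (rule H0_dominated(2))
  show "pos_homogeneous ((\<lambda>\<phi>. max (f \<phi>) (g \<phi>)) - (\<lambda>\<phi>. max (f' \<phi>) (g' \<phi>)))"
    using assms by (intro H0_pos_homogeneous diff_H0 max_H0)
qed (use assms in \<open>auto simp: diff_H0 max_def\<close>)

text \<open>A nonzero \<open>\<phi>\<close> divided by its norm is an admissible family of length
  one. Continuity of evaluation at \<open>\<phi>\<close> yields definiteness of the norm and the
  pointwise limits in the completeness proof.\<close>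

lemma H0_pointwise:
  assumes "f \<in> carrier H0"
  shows "\<bar>f \<phi>\<bar> \<le> fnorm f * norm \<phi>"
proof (cases "\<phi> = 0")
  case True
  \<comment> \<open>Homogeneity, assumed for positive factors, still forces \<open>f 0 = 0\<close>,
    since \<open>f 0 = 2 * f 0\<close>.\<close>
  have "f (2 *\<^sub>R 0) = 2 * f 0"
    by (rule H0_pos_homogeneous[OF assms, unfolded pos_homogeneous_def, rule_format]) simp
  then show ?thesis using True by simp
next
  case False
  let ?\<psi> = "(1 / norm \<phi>) *\<^sub>R \<phi>"
  have "\<bar>blinfun_apply ?\<psi> x\<bar> \<le> 1" if "norm x \<le> 1" for x
  proof -
    have "\<bar>blinfun_apply \<phi> x\<bar> \<le> norm \<phi> * 1"
      using norm_blinfun[of \<phi> x] mult_left_mono[OF that, of "norm \<phi>"] by simp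
    then show ?thesis using False by (simp add: blinfun.scaleR_left field_simps)
  qed
  then have "admissible 1 (\<lambda>_. ?\<psi>)" by (simp add: admissible_def)
  from sum_le_fnorm[OF assms this] have "\<bar>f ?\<psi>\<bar> \<le> fnorm f" by simp
  moreover have "f ?\<psi> = (1 / norm \<phi>) * f \<phi>"
    using H0_pos_homogeneous[OF assms] False unfolding pos_homogeneous_def by simp
  ultimately show ?thesis using False by (simp add: field_simps abs_mult)
qed

lemma fnorm_eq_0_iff:
  assumes "f \<in> carrier H0"
  shows "fnorm f = 0 \<longleftrightarrow> f = (\<lambda>_. 0)"
  using H0_pointwise[OF assms] by (auto simp: fnorm_zero)

text \<open>The limit is taken pointwise. Norm convergence follows by letting the second index tend
  to infinity in the finite sum over a fixed admissible family, with a bound that does not depend on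
  the family.\<close>

lemma H0_complete:
  assumes s: "\<And>n. s n \<in> carrier H0"
    and Cauchy: "\<And>e. e > 0 \<Longrightarrow> \<exists>N. \<forall>m\<ge>N. \<forall>n\<ge>N. fnorm (s m - s n) < e"
  obtains l where "l \<in> carrier H0" "(\<lambda>n. fnorm (s n - l)) \<longlonglongrightarrow> 0"
proof -
  have "Cauchy (\<lambda>n. s n \<phi>)" for \<phi>
  proof (rule CauchyI)
    fix e :: real assume "e > 0"
    \<comment> \<open>The added 1 keeps the denominator positive when
      \<open>\<phi> = 0\<close>.\<close>
    then have "e / (norm \<phi> + 1) > 0" by (simp add: add_nonneg_pos)
    from Cauchy[OF this] obtain N where N: "\<And>m n. m \<ge> N \<Longrightarrow> n \<ge> N \<Longrightarrow> fnorm (s m - s n) < e / (norm \<phi> + 1)"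
      by blast
    have "norm (s m \<phi> - s n \<phi>) < e" if "m \<ge> N" "n \<ge> N" for m n
    proof -
      have "norm (s m \<phi> - s n \<phi>) \<le> fnorm (s m - s n) * norm \<phi>"
        using H0_pointwise[OF diff_H0[OF s s], of m n \<phi>] by simp
      also have "\<dots> \<le> fnorm (s m - s n) * (norm \<phi> + 1)"
        by (intro mult_left_mono) (simp_all add: fnorm_nonneg)
      also have "\<dots> < e"
        using N[OF that] by (simp add: pos_less_divide_eq add_nonneg_pos)
      finally show ?thesis .
    qed
    then show "\<exists>N. \<forall>m\<ge>N. \<forall>n\<ge>N. norm (s m \<phi> - s n \<phi>) < e" by blast
  qed
  then have "\<forall>\<phi>. \<exists>L. (\<lambda>n. s n \<phi>) \<longlonglongrightarrow> L"
    by (simp add: Cauchy_convergent_iff convergent_def)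
  then obtain l where l: "\<And>\<phi>. (\<lambda>n. s n \<phi>) \<longlonglongrightarrow> l \<phi>"
    by metis
  have hom: "pos_homogeneous l"
    unfolding pos_homogeneous_def
  proof (intro allI impI)
    fix c :: real and \<phi> :: "'a \<Rightarrow>\<^sub>L real" assume "c > 0"
    then have "(\<lambda>n. s n (c *\<^sub>R \<phi>)) = (\<lambda>n. c * s n \<phi>)"
      using H0_pos_homogeneous[OF s] by (simp add: pos_homogeneous_def)
    then show "l (c *\<^sub>R \<phi>) = c * l \<phi>"
      using LIMSEQ_unique[OF l[of "c *\<^sub>R \<phi>"]] tendsto_mult_left[OF l[of \<phi>], of c] by simp
  qed
  have close: "s n - l \<in> carrier H0 \<and> fnorm (s n - l) \<le> e"
    if N: "\<And>m n. m \<ge> N \<Longrightarrow> n \<ge> N \<Longrightarrow> fnorm (s m - s n) < e" and n: "n \<ge> N" for N n e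
  proof -
    have "pos_homogeneous (s n - l)"
      using hom H0_pos_homogeneous[OF s[of n]] by (simp add: pos_homogeneous_def right_diff_distrib)
    moreover have "(\<Sum>i<k. \<bar>(s n - l) (\<phi> i)\<bar>) \<le> e"
      if adm: "admissible k \<phi>" for k and \<phi> :: "nat \<Rightarrow> 'a \<Rightarrow>\<^sub>L real"
    proof (rule LIMSEQ_le_const2)
      show "(\<lambda>m. \<Sum>i<k. \<bar>(s n - s m) (\<phi> i)\<bar>) \<longlonglongrightarrow> (\<Sum>i<k. \<bar>(s n - l) (\<phi> i)\<bar>)"
        unfolding fun_diff_def by (intro tendsto_sum tendsto_rabs tendsto_diff tendsto_const l)
      have "(\<Sum>i<k. \<bar>(s n - s m) (\<phi> i)\<bar>) \<le> e" if "m \<ge> N" for m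
        using sum_le_fnorm[OF diff_H0[OF s s] adm, of n m] N[OF n that] by simp
      then show "\<exists>M. \<forall>m\<ge>M. (\<Sum>i<k. \<bar>(s n - s m) (\<phi> i)\<bar>) \<le> e" by blast
    qed
    ultimately show ?thesis using H0I by blast
  qed
  show thesis
  proof
    from Cauchy[of 1] obtain N where "\<And>m n. m \<ge> N \<Longrightarrow> n \<ge> N \<Longrightarrow> fnorm (s m - s n) < 1" by auto
    from close[OF this order_refl] have "s N - l \<in> carrier H0" by simp
    from diff_H0[OF s[of N] this] show "l \<in> carrier H0" by (simp add: fun_diff_def)
    show "(\<lambda>n. fnorm (s n - l)) \<longlonglongrightarrow> 0"
    proof (rule LIMSEQ_I)
      fix r :: real assume "0 < r"
      \<comment> \<open>Passing to the limit in \<open>close\<close> leaves only a weak inequality,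
        hence the half.\<close>
      then obtain N where N: "\<And>m n. m \<ge> N \<Longrightarrow> n \<ge> N \<Longrightarrow> fnorm (s m - s n) < r / 2"
        using Cauchy[of "r / 2"] by auto
      have "norm (fnorm (s n - l) - 0) < r" if "n \<ge> N" for n
        using close[OF N that] \<open>0 < r\<close> by (simp add: fnorm_nonneg)
      then show "\<exists>N. \<forall>n\<ge>N. norm (fnorm (s n - l) - 0) < r" by blast
    qed
  qed
qed

section \<open>Pointwise sublattices of the ambient lattice\<close>

lemma carrier_update_self:
  fixes R :: "('a, 'm) partial_object_scheme"
  shows "R\<lparr>carrier := carrier R\<rparr> = R"
  by simp

text \<open>A common frame for \<open>H0\<close> and \<open>FBL\<close>, so that the order, the
  lattice operations and the module structure are computed pointwise once for both. Closedness in
  norm is kept apart as \<open>fnorm_closed\<close>.\<close>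

locale fun_sublattice =
  fixes C :: "'e::banach dual_fun set"
  assumes subset: "C \<subseteq> carrier H0"
    and zero: "(\<lambda>_. 0) \<in> C"
    and add: "\<lbrakk>f \<in> C; g \<in> C\<rbrakk> \<Longrightarrow> (\<lambda>\<phi>. f \<phi> + g \<phi>) \<in> C"
    and scale: "f \<in> C \<Longrightarrow> (\<lambda>\<phi>. c * f \<phi>) \<in> C"
    and max: "\<lbrakk>f \<in> C; g \<in> C\<rbrakk> \<Longrightarrow> (\<lambda>\<phi>. max (f \<phi>) (g \<phi>)) \<in> C"

lemma fun_sublattice_H0: "fun_sublattice (carrier H0)"
  by unfold_locales (auto intro: zero_H0 add_H0 scale_H0 max_H0)

context fun_sublattice
begin

abbreviation Y :: "'e dual_fun vlattice" where "Y \<equiv> H0\<lparr>carrier := C\<rparr>"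

lemma in_H0: "f \<in> C \<Longrightarrow> f \<in> carrier H0"
  using subset by blast

lemma uminus: "f \<in> C \<Longrightarrow> - f \<in> C"
  using scale[of f "-1"] by (simp add: fun_Compl_def)

lemma diff: "f \<in> C \<Longrightarrow> g \<in> C \<Longrightarrow> f - g \<in> C"
  using add[OF _ uminus] by (simp add: fun_diff_def)

lemma min: "f \<in> C \<Longrightarrow> g \<in> C \<Longrightarrow> (\<lambda>\<phi>. min (f \<phi>) (g \<phi>)) \<in> C"
  using uminus[OF max[OF uminus uminus], of f g]
  by (simp add: fun_Compl_def minus_max_eq_min)

lemma abelian_group: "abelian_group Y"
  by (rule abelian_groupI)
    (auto simp: zero add algebra_simps intro!: bexI[of _ "- _"] intro: uminus)

lemma a_inv [simp]: "f \<in> C \<Longrightarrow> \<ominus>\<^bsub>Y\<^esub> f = - f"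
proof -
  interpret abelian_group Y by (rule abelian_group)
  show "f \<in> C \<Longrightarrow> \<ominus>\<^bsub>Y\<^esub> f = - f"
    by (rule minus_equality) (auto intro: uminus)
qed

lemma a_minus [simp]: "g \<in> C \<Longrightarrow> f \<ominus>\<^bsub>Y\<^esub> g = f - g"
  by (auto simp: a_minus_def)

lemma module: "Module.module real_ring Y"
  by (rule moduleI[OF cring_real_ring abelian_group])
     (auto simp: real_ring_def scale algebra_simps)

lemma submodule_H0: "submodule C real_ring H0"
proof -
  interpret H: fun_sublattice "carrier H0"
    by (rule fun_sublattice_H0)
  interpret Module.module real_ring H0 using H.module unfolding carrier_update_self .
  show ?thesis
    by (rule submoduleI)
       (use subset in \<open>auto simp: H.a_inv[unfolded carrier_update_self] zero add scale uminus in_H0\<close>)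
qed

lemma least_max:
  "f \<in> C \<Longrightarrow> g \<in> C \<Longrightarrow> least (vorder Y) (\<lambda>\<phi>. max (f \<phi>) (g \<phi>)) (Upper (vorder Y) {f, g})"
  by (auto simp: least_def Upper_def vorder_def max le_fun_def)

lemma greatest_min:
  "f \<in> C \<Longrightarrow> g \<in> C \<Longrightarrow> greatest (vorder Y) (\<lambda>\<phi>. min (f \<phi>) (g \<phi>)) (Lower (vorder Y) {f, g})"
  by (auto simp: greatest_def Lower_def vorder_def min le_fun_def)

lemma partial_order: "Order.partial_order (vorder Y)"
  by unfold_locales (auto simp: vorder_def)

lemma lattice: "Lattice.lattice (vorder Y)"
proof -
  interpret Order.partial_order "vorder Y" by (rule partial_order)
  have carrier: "carrier (vorder Y) = C" by (simp add: vorder_def)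
  show ?thesis
  proof unfold_locales
    fix f g assume "f \<in> carrier (vorder Y)" "g \<in> carrier (vorder Y)"
    then have "f \<in> C" "g \<in> C" by (simp_all add: carrier)
    from least_max[OF this] greatest_min[OF this]
    show "\<exists>s. least (vorder Y) s (Upper (vorder Y) {f, g})"
      "\<exists>s. greatest (vorder Y) s (Lower (vorder Y) {f, g})" by - (rule exI, assumption)+
  qed
qed

lemma vjoin [simp]: "f \<in> C \<Longrightarrow> g \<in> C \<Longrightarrow> vjoin Y f g = (\<lambda>\<phi>. max (f \<phi>) (g \<phi>))"
proof -
  interpret Order.partial_order "vorder Y" by (rule partial_order)
  show "f \<in> C \<Longrightarrow> g \<in> C \<Longrightarrow> vjoin Y f g = (\<lambda>\<phi>. max (f \<phi>) (g \<phi>))"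
    unfolding vjoin_def join_def Lattice.sup_def
    by (rule some_equality) (use least_max least_unique in blast)+
qed

lemma vmeet [simp]: "f \<in> C \<Longrightarrow> g \<in> C \<Longrightarrow> vmeet Y f g = (\<lambda>\<phi>. min (f \<phi>) (g \<phi>))"
proof -
  interpret Order.partial_order "vorder Y" by (rule partial_order)
  show "f \<in> C \<Longrightarrow> g \<in> C \<Longrightarrow> vmeet Y f g = (\<lambda>\<phi>. min (f \<phi>) (g \<phi>))"
    unfolding vmeet_def meet_def Lattice.inf_def
    by (rule some_equality) (use greatest_min greatest_unique in blast)+
qed

lemma vabs [simp]: "f \<in> C \<Longrightarrow> vabs Y f = (\<lambda>\<phi>. \<bar>f \<phi>\<bar>)"
  by (auto simp: vabs_def uminus max_def abs_real_def)

lemma vtendsto: "l \<in> C \<Longrightarrow> vtendsto Y s l \<longleftrightarrow> (\<lambda>n. fnorm (s n - l)) \<longlonglongrightarrow> 0"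
  by (simp add: vtendsto_def)

end

interpretation H0: fun_sublattice "carrier (H0 :: 'e::banach dual_fun vlattice)"
  rewrites "H0\<lparr>carrier := carrier H0\<rparr> = (H0 :: 'e::banach dual_fun vlattice)"
  by (rule fun_sublattice_H0) (rule carrier_update_self)

definition fnorm_closed :: "'e::banach dual_fun set \<Rightarrow> bool" where
  "fnorm_closed C \<longleftrightarrow>
     (\<forall>s l. (\<forall>n. s n \<in> C) \<longrightarrow> l \<in> carrier H0 \<longrightarrow> (\<lambda>n. fnorm (s n - l)) \<longlonglongrightarrow> 0 \<longrightarrow> l \<in> C)"

lemma norm_closed_H0_iff: "norm_closed H0 C \<longleftrightarrow> fnorm_closed C"
  unfolding norm_closed_def fnorm_closed_def by (simp add: H0.vtendsto cong: imp_cong)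

lemma closed_sublattice_H0_iff: "closed_sublattice H0 C \<longleftrightarrow> fun_sublattice C \<and> fnorm_closed C"
proof
  assume C: "closed_sublattice H0 C"
  then interpret submodule C real_ring H0 by (simp add: closed_sublattice_def)
  have subset: "C \<subseteq> carrier H0" using subset by simp
  have sup: "vjoin H0 f g \<in> C" if "f \<in> C" "g \<in> C" for f g
    using C that by (simp add: closed_sublattice_def)
  have "fun_sublattice C"
  proof
    show "(\<lambda>\<phi>. max (f \<phi>) (g \<phi>)) \<in> C" if "f \<in> C" "g \<in> C" for f g
      using sup[OF that] subsetD[OF subset that(1)] subsetD[OF subset that(2)] by (simp only: H0.vjoin)
    show "(\<lambda>_. 0) \<in> C" using one_closed by simp
    show "(\<lambda>\<phi>. f \<phi> + g \<phi>) \<in> C" if "f \<in> C" "g \<in> C" for f g using m_closed[OF that] by simp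
    show "(\<lambda>\<phi>. c * f \<phi>) \<in> C" if "f \<in> C" for f c using smult_closed[of c f] that by (simp add: real_ring_def)
  qed (rule subset)
  moreover have "fnorm_closed C"
    using C by (simp add: closed_sublattice_def norm_closed_H0_iff)
  ultimately show "fun_sublattice C \<and> fnorm_closed C" ..
next
  assume C: "fun_sublattice C \<and> fnorm_closed C"
  then interpret fun_sublattice C by simp
  show "closed_sublattice H0 C"
    using C submodule_H0
    by (auto simp: closed_sublattice_def norm_closed_H0_iff in_H0 max min)
qed

context fun_sublattice
begin

text \<open>A Cauchy sequence converges in \<open>H0\<close>, and closedness keeps its limit in
  \<open>C\<close>; the remaining axioms hold pointwise or are inherited from
  \<open>H0\<close>.\<close>

lemma banach_lattice_on:
  assumes "fnorm_closed C"
  shows "banach_lattice_on Y"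
proof (rule banach_lattice_on.intro)
  fix s assume s: "\<And>n. s n \<in> carrier Y" and "vCauchy Y s"
  then have "\<And>e. e > 0 \<Longrightarrow> \<exists>N. \<forall>m\<ge>N. \<forall>n\<ge>N. fnorm (s m - s n) < e"
    by (simp add: vCauchy_def)
  moreover have "s n \<in> carrier H0" for n using s in_H0 by simp
  ultimately obtain l where l: "l \<in> carrier H0" "(\<lambda>n. fnorm (s n - l)) \<longlonglongrightarrow> 0"
    using H0_complete[of s] by blast
  with assms s have "l \<in> C" unfolding fnorm_closed_def by auto
  with l(2) show "\<exists>l\<in>carrier Y. vtendsto Y s l" by (auto simp: vtendsto)
next
  fix x y assume "x \<in> carrier Y" "y \<in> carrier Y" "vle Y (vabs Y x) (vabs Y y)"
  then show "vnorm Y x \<le> vnorm Y y"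
    by (auto simp: le_fun_def intro!: fnorm_mono in_H0)
qed (auto simp: module lattice le_fun_def mult_left_mono fnorm_nonneg fnorm_eq_0_iff in_H0
    add_H0 scale_H0)

end

section \<open>The canonical map onto the Banach lattice\<close>

lemma fnorm_add_diff:
  assumes "f \<in> carrier H0" "g \<in> carrier H0" "f' \<in> carrier H0" "g' \<in> carrier H0"
  shows "fnorm ((\<lambda>\<phi>. f \<phi> + g \<phi>) - (\<lambda>\<phi>. f' \<phi> + g' \<phi>)) \<le> fnorm (f - f') + fnorm (g - g')"
proof (rule H0_dominated(2))
  show "pos_homogeneous ((\<lambda>\<phi>. f \<phi> + g \<phi>) - (\<lambda>\<phi>. f' \<phi> + g' \<phi>))"
    using assms by (intro H0_pos_homogeneous diff_H0 add_H0)
qed (use assms in \<open>auto simp: diff_H0\<close>)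

lemma fnorm_diff_commute:
  assumes "f \<in> carrier H0" "g \<in> carrier H0"
  shows "fnorm (f - g) = fnorm (g - f)"
  using assms by (intro antisym fnorm_mono diff_H0) (simp_all add: abs_minus_commute)

lemma fnorm_diff_triangle:
  assumes "f \<in> carrier H0" "g \<in> carrier H0" "h \<in> carrier H0"
  shows "fnorm (f - h) \<le> fnorm (f - g) + fnorm (g - h)"
  using assms by (intro H0_dominated(2) diff_H0 H0_pos_homogeneous) simp_all

lemma fnorm_le_diff:
  assumes "f \<in> carrier H0" "g \<in> carrier H0"
  shows "fnorm g \<le> fnorm f + fnorm (f - g)"
  using assms by (intro H0_dominated(2) diff_H0 H0_pos_homogeneous) simp_all

lemma fbl_delta_H0:
  fixes x :: "'e::banach"
  shows "fbl_delta x \<in> carrier H0" and "fnorm (fbl_delta x) \<le> norm x"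
proof -
  have "pos_homogeneous (fbl_delta x)"
    by (simp add: pos_homogeneous_def fbl_delta_def blinfun.scaleR_left)
  moreover have "(\<Sum>i<n. \<bar>fbl_delta x (\<phi> i)\<bar>) \<le> norm x"
    if adm: "admissible n \<phi>" for n and \<phi> :: "nat \<Rightarrow> 'e \<Rightarrow>\<^sub>L real"
  proof (cases "x = 0")
    case False
    have "(1 / norm x) *\<^sub>R x \<in> cball 0 1" using False by simp
    with adm have "(\<Sum>i<n. \<bar>blinfun_apply (\<phi> i) ((1 / norm x) *\<^sub>R x)\<bar>) \<le> 1"
      unfolding admissible_def by blast
    then have "(1 / norm x) * (\<Sum>i<n. \<bar>fbl_delta x (\<phi> i)\<bar>) \<le> 1"
      by (simp add: blinfun.scaleR_right abs_mult sum_distrib_left fbl_delta_def)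
    then show ?thesis using False by (simp add: field_simps)
  qed (simp add: fbl_delta_def blinfun.zero_right)
  ultimately show "fbl_delta x \<in> carrier H0" "fnorm (fbl_delta x) \<le> norm x"
    using H0I by blast+
qed

text \<open>
  A substitute for ``\<open>f\<close> and \<open>x\<close> arise from the same lattice-linear expression, applied to
  evaluations and to elements of the lattice respectively'', which needs no syntax of expressions.
\<close>

definition represents :: "'a::banach_lattice dual_fun \<Rightarrow> 'a \<Rightarrow> bool" where
  "represents f x \<longleftrightarrow> f \<in> carrier H0 \<and>
     (\<exists>W. finite W \<and> (\<forall>\<phi>. pos_functional \<phi> \<longrightarrow> (\<forall>w\<in>W. splits \<phi> w) \<longrightarrow> f \<phi> = blinfun_apply \<phi> x))"

lemma representsE:
  assumes "represents f x"
  obtains W where "f \<in> carrier H0" "finite W"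
    "\<And>\<phi>. pos_functional \<phi> \<Longrightarrow> \<forall>w\<in>W. splits \<phi> w \<Longrightarrow> f \<phi> = blinfun_apply \<phi> x"
  using assms unfolding represents_def by blast

lemma represents_delta: "represents (fbl_delta x) x"
  unfolding represents_def
  by (intro conjI fbl_delta_H0 exI[of _ "{}"]) (simp_all add: fbl_delta_def)

lemma represents_add:
  assumes "represents f x" "represents g y"
  shows "represents (\<lambda>\<phi>. f \<phi> + g \<phi>) (x + y)"
proof -
  obtain V where V: "f \<in> carrier H0" "finite V" "\<And>\<phi>. pos_functional \<phi> \<Longrightarrow> \<forall>w\<in>V. splits \<phi> w \<Longrightarrow> f \<phi> = blinfun_apply \<phi> x"
    using assms(1) by (rule representsE) blast
  obtain W where W: "g \<in> carrier H0" "finite W" "\<And>\<phi>. pos_functional \<phi> \<Longrightarrow> \<forall>w\<in>W. splits \<phi> w \<Longrightarrow> g \<phi> = blinfun_apply \<phi> y"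
    using assms(2) by (rule representsE) blast
  show ?thesis
    unfolding represents_def using V W
    by (intro conjI add_H0 exI[of _ "V \<union> W"]) (auto simp: blinfun.add_right)
qed

lemma represents_scale:
  assumes "represents f x"
  shows "represents (\<lambda>\<phi>. c * f \<phi>) (c *\<^sub>R x)"
proof -
  obtain V where V: "f \<in> carrier H0" "finite V" "\<And>\<phi>. pos_functional \<phi> \<Longrightarrow> \<forall>w\<in>V. splits \<phi> w \<Longrightarrow> f \<phi> = blinfun_apply \<phi> x"
    using assms by (rule representsE) blast
  show ?thesis
    unfolding represents_def using V
    by (intro conjI scale_H0 exI[of _ V]) (auto simp: blinfun.scaleR_right)
qed

text \<open>The element \<open>x - y\<close> joins the finite sets of both operands, so that every
  functional under consideration takes the join of \<open>x\<close> and \<open>y\<close> to a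
  maximum.\<close>

lemma represents_max:
  assumes "represents f x" "represents g y"
  shows "represents (\<lambda>\<phi>. max (f \<phi>) (g \<phi>)) (sup x y)"
proof -
  obtain V where V: "f \<in> carrier H0" "finite V" "\<And>\<phi>. pos_functional \<phi> \<Longrightarrow> \<forall>w\<in>V. splits \<phi> w \<Longrightarrow> f \<phi> = blinfun_apply \<phi> x"
    using assms(1) by (rule representsE) blast
  obtain W where W: "g \<in> carrier H0" "finite W" "\<And>\<phi>. pos_functional \<phi> \<Longrightarrow> \<forall>w\<in>W. splits \<phi> w \<Longrightarrow> g \<phi> = blinfun_apply \<phi> y"
    using assms(2) by (rule representsE) blast
  show ?thesis
    unfolding represents_def using V W
    by (intro conjI max_H0 exI[of _ "insert (x - y) (V \<union> W)"]) (auto simp: splits_sup)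
qed

text \<open>
  Decompose a norming functional of \<open>|x|\<close> into positive functionals that split everything relevant;
  the pieces form an admissible family at which \<open>f\<close> takes the values of the pieces at \<open>x\<close>.
\<close>

lemma represents_norm_le:
  fixes x :: "'a::banach_lattice"
  assumes "represents f x"
  shows "norm x \<le> fnorm f"
proof -
  obtain W where W: "f \<in> carrier H0" "finite W"
    "\<And>\<phi>. pos_functional \<phi> \<Longrightarrow> \<forall>w\<in>W. splits \<phi> w \<Longrightarrow> f \<phi> = blinfun_apply \<phi> x"
    using assms by (rule representsE) blast
  obtain \<phi> where \<phi>: "pos_functional \<phi>" "\<And>y. blinfun_apply \<phi> y \<le> norm y"
    "blinfun_apply \<phi> (sup x (- x)) = norm x"
    using norming_pos_functional[of x] by blast
  \<comment> \<open>The element \<open>x - (- x)\<close> is included so that each piece maps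
    \<open>sup x (- x)\<close> to the absolute value of its value at \<open>x\<close>.\<close>
  obtain \<psi>s where sum: "\<phi> = sum_list \<psi>s"
    and \<psi>s: "\<forall>\<psi>\<in>set \<psi>s. pos_functional \<psi> \<and> pos_functional (\<phi> - \<psi>) \<and> (\<forall>w\<in>insert (x - (- x)) W. splits \<psi> w)"
    using pos_functional_split_finite[OF _ \<phi>(1), of "insert (x - (- x)) W"] W(2) by blast
  define n where "n = length \<psi>s"
  define \<psi> where "\<psi> i = \<psi>s ! i" for i
  have \<psi>: "pos_functional (\<psi> i)" "splits (\<psi> i) (x - (- x))" "\<forall>w\<in>W. splits (\<psi> i) w" if "i < n" for i
    using \<psi>s that by (simp_all add: n_def \<psi>_def)
  have apply_sum: "blinfun_apply \<phi> y = (\<Sum>i<n. blinfun_apply (\<psi> i) y)" for y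
    by (simp add: sum sum_list_sum_nth n_def \<psi>_def blinfun.sum_left atLeast0LessThan)
  \<comment> \<open>By positivity of the pieces, the absolute values at \<open>y\<close> add up to
    at most \<open>\<phi> (sup y (- y))\<close>, hence to at most \<open>norm y\<close>.\<close>
  have "admissible n \<psi>"
    unfolding admissible_def
  proof
    fix y :: 'a assume y: "y \<in> cball 0 1"
    have "(\<Sum>i<n. \<bar>blinfun_apply (\<psi> i) y\<bar>) \<le> blinfun_apply \<phi> (sup y (- y))"
      unfolding apply_sum by (intro sum_mono pos_functional_abs_le \<psi>) simp
    also have "\<dots> \<le> norm y" using \<phi>(2)[of "sup y (- y)"] by (simp add: norm_abs)
    finally show "(\<Sum>i<n. \<bar>blinfun_apply (\<psi> i) y\<bar>) \<le> 1" using y by simp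
  qed
  have "norm x = (\<Sum>i<n. blinfun_apply (\<psi> i) (sup x (- x)))"
    by (simp flip: \<phi>(3) apply_sum)
  also have "\<dots> = (\<Sum>i<n. \<bar>f (\<psi> i)\<bar>)"
  proof (rule sum.cong)
    fix i assume "i \<in> {..<n}"
    then show "blinfun_apply (\<psi> i) (sup x (- x)) = \<bar>f (\<psi> i)\<bar>"
      using \<psi>[of i] W(3)[of "\<psi> i"] by (simp only: lessThan_iff splits_sup blinfun.minus_right) auto
  qed simp
  also have "\<dots> \<le> fnorm f" by (rule sum_le_fnorm) fact+
  finally show ?thesis .
qed

text \<open>The closure of the relation \<open>represents\<close> in the product of
  \<open>H0\<close> and the lattice. Restricted to \<open>FBL\<close> it turns out to be the graph
  of the canonical map.\<close>

definition represents_lim :: "'a::banach_lattice dual_fun \<Rightarrow> 'a \<Rightarrow> bool" where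
  "represents_lim f x \<longleftrightarrow> f \<in> carrier H0 \<and>
     (\<forall>e>0. \<exists>g y. represents g y \<and> fnorm (f - g) < e \<and> norm (x - y) < e)"

lemma represents_limE:
  assumes "represents_lim f x" "e > 0"
  obtains g y where "represents g y" "g \<in> carrier H0" "fnorm (f - g) < e" "norm (x - y) < e"
  using assms unfolding represents_lim_def represents_def by metis

lemma represents_limI:
  assumes "f \<in> carrier H0"
    and "\<And>e. e > 0 \<Longrightarrow> \<exists>g y. represents g y \<and> fnorm (f - g) < e \<and> norm (x - y) < e"
  shows "represents_lim f x"
  using assms unfolding represents_lim_def by blast

lemma represents_lim_H0: "represents_lim f x \<Longrightarrow> f \<in> carrier H0"
  by (simp add: represents_lim_def)

lemma represents_lim_delta: "represents_lim (fbl_delta x) x"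
proof (rule represents_limI)
  fix e :: real assume "e > 0"
  have "fbl_delta x - fbl_delta x = (\<lambda>_. 0)" by (simp add: fun_diff_def)
  then show "\<exists>g y. represents g y \<and> fnorm (fbl_delta x - g) < e \<and> norm (x - y) < e"
    using \<open>e > 0\<close> represents_delta[of x]
    by (intro exI[of _ "fbl_delta x"] exI[of _ x]) (simp add: fnorm_zero)
qed (rule fbl_delta_H0)

lemma represents_lim_add:
  assumes f: "represents_lim f x" and g: "represents_lim g y"
  shows "represents_lim (\<lambda>\<phi>. f \<phi> + g \<phi>) (x + y)"
proof (rule represents_limI)
  show "(\<lambda>\<phi>. f \<phi> + g \<phi>) \<in> carrier H0" using assms[THEN represents_lim_H0] by (rule add_H0)
  fix e :: real assume "e > 0"
  then have e: "e / 2 > 0" by simp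
  obtain f' x' where f': "represents f' x'" "f' \<in> carrier H0" "fnorm (f - f') < e / 2" "norm (x - x') < e / 2"
    by (rule represents_limE[OF f e])
  obtain g' y' where g': "represents g' y'" "g' \<in> carrier H0" "fnorm (g - g') < e / 2" "norm (y - y') < e / 2"
    by (rule represents_limE[OF g e])
  have "norm ((x + y) - (x' + y')) < e"
    using norm_diff_triangle_ineq[of x y x' y'] f'(4) g'(4) by simp
  moreover have "fnorm ((\<lambda>\<phi>. f \<phi> + g \<phi>) - (\<lambda>\<phi>. f' \<phi> + g' \<phi>)) < e"
    using fnorm_add_diff[OF represents_lim_H0[OF f] represents_lim_H0[OF g] f'(2) g'(2)] f'(3) g'(3) by simp
  ultimately show "\<exists>h z. represents h z \<and> fnorm ((\<lambda>\<phi>. f \<phi> + g \<phi>) - h) < e \<and> norm ((x + y) - z) < e"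
    using represents_add[OF f'(1) g'(1)] by blast
qed

lemma represents_lim_scale:
  assumes f: "represents_lim f x"
  shows "represents_lim (\<lambda>\<phi>. c * f \<phi>) (c *\<^sub>R x)"
proof (rule represents_limI)
  show "(\<lambda>\<phi>. c * f \<phi>) \<in> carrier H0" using represents_lim_H0[OF f] by (rule scale_H0)
  fix e :: real assume "e > 0"
  \<comment> \<open>The added 1 covers the case \<open>c = 0\<close>.\<close>
  then have e: "e / (\<bar>c\<bar> + 1) > 0" by (simp add: add_nonneg_pos)
  obtain f' x' where f': "represents f' x'" "f' \<in> carrier H0"
    "fnorm (f - f') < e / (\<bar>c\<bar> + 1)" "norm (x - x') < e / (\<bar>c\<bar> + 1)"
    by (rule represents_limE[OF f e])
  have scale: "\<bar>c\<bar> * r < e" if "0 \<le> r" "r < e / (\<bar>c\<bar> + 1)" for r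
  proof -
    have "\<bar>c\<bar> * r \<le> r * (\<bar>c\<bar> + 1)" using that(1) by (simp add: algebra_simps)
    also have "\<dots> < e" using that(2) by (simp add: pos_less_divide_eq add_nonneg_pos)
    finally show ?thesis .
  qed
  have "norm (c *\<^sub>R x - c *\<^sub>R x') < e"
    using scale[OF _ f'(4)] by (simp flip: scaleR_diff_right)
  moreover have "(\<lambda>\<phi>. c * f \<phi>) - (\<lambda>\<phi>. c * f' \<phi>) = (\<lambda>\<phi>. c * (f - f') \<phi>)"
    by (simp add: fun_eq_iff right_diff_distrib)
  then have "fnorm ((\<lambda>\<phi>. c * f \<phi>) - (\<lambda>\<phi>. c * f' \<phi>)) < e"
    using scale[OF _ f'(3)] scale_H0(2)[OF diff_H0[OF represents_lim_H0[OF f] f'(2)], of c]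
    by (simp only: fnorm_nonneg)
  ultimately show "\<exists>h z. represents h z \<and> fnorm ((\<lambda>\<phi>. c * f \<phi>) - h) < e \<and> norm (c *\<^sub>R x - z) < e"
    using represents_scale[OF f'(1)] by blast
qed

text \<open>With \<open>u\<close> and \<open>v\<close> the absolute values of the two differences,
  each join exceeds the other by at most \<open>u + v\<close>. Hence \<open>u + v\<close> dominates
  the absolute value of the difference of the joins.\<close>

lemma norm_sup_diff_le:
  fixes x y x' y' :: "'a::banach_lattice"
  shows "norm (sup x y - sup x' y') \<le> norm (x - x') + norm (y - y')"
proof -
  define u v where "u = sup (x - x') (- (x - x'))" and "v = sup (y - y') (- (y - y'))"
  have u: "x - x' \<le> u" "x' - x \<le> u" and v: "y - y' \<le> v" "y' - y \<le> v"
    by (simp_all add: u_def v_def)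
  have nonneg: "0 \<le> u" "0 \<le> v" unfolding u_def v_def by (rule sup_uminus_nonneg)+
  have le: "sup a b \<le> sup a' b' + (u + v)" if "a - a' \<le> u" "b - b' \<le> v" for a b a' b'
  proof (rule sup_least)
    have "a \<le> a' + u" using that(1) by (simp add: diff_le_eq add.commute)
    also have "\<dots> \<le> sup a' b' + (u + v)" using nonneg by (intro add_mono) auto
    finally show "a \<le> sup a' b' + (u + v)" .
    have "b \<le> b' + v" using that(2) by (simp add: diff_le_eq add.commute)
    also have "\<dots> \<le> sup a' b' + (u + v)" using nonneg by (intro add_mono) auto
    finally show "b \<le> sup a' b' + (u + v)" .
  qed
  have "sup x y - sup x' y' \<le> u + v"
    using le[OF u(1) v(1)] by (simp only: diff_le_eq add.commute)
  moreover have "- (sup x y - sup x' y') \<le> u + v"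
    using le[OF u(2) v(2)] by (simp only: minus_diff_eq diff_le_eq add.commute)
  ultimately have "norm (sup (sup x y - sup x' y') (- (sup x y - sup x' y'))) \<le> norm (u + v)"
    by (intro norm_mono sup_uminus_nonneg sup_least)
  also have "\<dots> \<le> norm u + norm v" by (rule norm_triangle_ineq)
  finally show ?thesis by (simp only: norm_abs u_def v_def)
qed

lemma represents_lim_max:
  assumes f: "represents_lim f x" and g: "represents_lim g y"
  shows "represents_lim (\<lambda>\<phi>. max (f \<phi>) (g \<phi>)) (sup x y)"
proof (rule represents_limI)
  show "(\<lambda>\<phi>. max (f \<phi>) (g \<phi>)) \<in> carrier H0" using assms[THEN represents_lim_H0] by (rule max_H0)
  fix e :: real assume "e > 0"
  then have e: "e / 2 > 0" by simp
  obtain f' x' where f': "represents f' x'" "f' \<in> carrier H0" "fnorm (f - f') < e / 2" "norm (x - x') < e / 2"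
    by (rule represents_limE[OF f e])
  obtain g' y' where g': "represents g' y'" "g' \<in> carrier H0" "fnorm (g - g') < e / 2" "norm (y - y') < e / 2"
    by (rule represents_limE[OF g e])
  have "norm (sup x y - sup x' y') < e"
    using norm_sup_diff_le[of x y x' y'] f'(4) g'(4) by simp
  moreover have "fnorm ((\<lambda>\<phi>. max (f \<phi>) (g \<phi>)) - (\<lambda>\<phi>. max (f' \<phi>) (g' \<phi>))) < e"
    using fnorm_max_diff[OF represents_lim_H0[OF f] represents_lim_H0[OF g] f'(2) g'(2)] f'(3) g'(3) by simp
  ultimately show "\<exists>h z. represents h z \<and> fnorm ((\<lambda>\<phi>. max (f \<phi>) (g \<phi>)) - h) < e \<and> norm (sup x y - z) < e"
    using represents_max[OF f'(1) g'(1)] by blast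
qed

lemma represents_lim_norm_le:
  assumes f: "represents_lim f x"
  shows "norm x \<le> fnorm f"
proof (rule field_le_epsilon)
  fix e :: real assume "e > 0"
  then have e: "e / 2 > 0" by simp
  obtain f' x' where f': "represents f' x'" "f' \<in> carrier H0" "fnorm (f - f') < e / 2" "norm (x - x') < e / 2"
    by (rule represents_limE[OF f e])
  show "norm x \<le> fnorm f + e"
    using norm_triangle_sub[of x x'] represents_norm_le[OF f'(1)] fnorm_le_diff[OF represents_lim_H0[OF f] f'(2)]
      f'(3,4) by linarith
qed

lemma represents_lim_diff:
  assumes "represents_lim f x" "represents_lim g y"
  shows "represents_lim (f - g) (x - y)"
  using represents_lim_add[OF assms(1) represents_lim_scale[OF assms(2), of "-1"]]
  by (simp add: fun_diff_def)

text \<open>The function \<open>f - f = 0\<close> represents \<open>x - y\<close>, so the norm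
  inequality gives \<open>x = y\<close>. This makes the canonical map well defined.\<close>

lemma represents_lim_unique:
  assumes "represents_lim f x" "represents_lim f y"
  shows "x = y"
proof -
  have "f - f = (\<lambda>_. 0)" by (simp add: fun_diff_def)
  then show ?thesis
    using represents_lim_norm_le[OF represents_lim_diff[OF assms]] by (simp add: fnorm_zero)
qed

text \<open>By the norm inequality the represented elements of a convergent sequence form a Cauchy
  sequence. Completeness of the lattice supplies their limit, and approximants of a late member of
  the sequence serve for the limit function.\<close>

lemma represents_lim_closed: "fnorm_closed {f. \<exists>x. represents_lim f x}"
  unfolding fnorm_closed_def
proof (intro allI impI)
  fix s and l :: "'a dual_fun"
  assume "\<forall>n. s n \<in> {f. \<exists>x. represents_lim f x}" and l: "l \<in> carrier H0"
    and lim: "(\<lambda>n. fnorm (s n - l)) \<longlonglongrightarrow> 0"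
  then obtain x where x: "\<And>n. represents_lim (s n) (x n)" by simp metis
  note s = x[THEN represents_lim_H0]
  have small: "\<exists>N. \<forall>n\<ge>N. fnorm (s n - l) < e" if "e > 0" for e
    using LIMSEQ_D[OF lim that] by (simp add: fnorm_nonneg)
  have "Cauchy x"
  proof (rule CauchyI)
    fix e :: real assume "e > 0"
    then obtain N where N: "\<And>n. n \<ge> N \<Longrightarrow> fnorm (s n - l) < e / 2"
      using small[of "e / 2"] by auto
    have "norm (x m - x n) < e" if "m \<ge> N" "n \<ge> N" for m n
      using represents_lim_norm_le[OF represents_lim_diff[OF x x], of m n] fnorm_diff_triangle[OF s l s, of m n]
        fnorm_diff_commute[OF s l, of n] N[OF that(1)] N[OF that(2)] by linarith
    then show "\<exists>N. \<forall>m\<ge>N. \<forall>n\<ge>N. norm (x m - x n) < e" by blast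
  qed
  then obtain z where z: "x \<longlonglongrightarrow> z" using Cauchy_convergent convergent_def by blast
  have "represents_lim l z"
  proof (rule represents_limI[OF l])
    fix e :: real assume "e > 0"
    then have e: "e / 2 > 0" by simp
    obtain N where N: "\<And>n. n \<ge> N \<Longrightarrow> fnorm (s n - l) < e / 2" using small[OF e] by blast
    obtain M where M: "\<And>n. n \<ge> M \<Longrightarrow> norm (x n - z) < e / 2" using LIMSEQ_D[OF z e] by blast
    define n where "n = max M N"
    obtain g y where g: "represents g y" "g \<in> carrier H0" "fnorm (s n - g) < e / 2" "norm (x n - y) < e / 2"
      by (rule represents_limE[OF x e])
    have "fnorm (l - g) < e"
      using fnorm_diff_triangle[OF l s g(2), of n] fnorm_diff_commute[OF s l, of n] N[of n] g(3)
      by (simp add: n_def)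
    moreover have "norm (z - y) < e"
      using norm_diff_triangle_less[OF _ g(4), of z "e / 2"] M[of n] by (simp add: n_def norm_minus_commute)
    ultimately show "\<exists>g y. represents g y \<and> fnorm (l - g) < e \<and> norm (z - y) < e" using g(1) by blast
  qed
  then show "l \<in> {f. \<exists>x. represents_lim f x}" by blast
qed

section \<open>The free Banach lattice and its canonical homomorphism\<close>

lemma carrier_FBL: "carrier FBL = \<Inter>{S. closed_sublattice H0 S \<and> range fbl_delta \<subseteq> S}"
  by (simp add: FBL_def)

text \<open>The induction principle for \<open>FBL\<close>: it gives both the existence of
  represented elements and the uniqueness of homomorphisms.\<close>

lemma FBL_least:
  assumes "fun_sublattice S" "fnorm_closed S" "range fbl_delta \<subseteq> S"
  shows "carrier FBL \<subseteq> S"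
  unfolding carrier_FBL using assms by (intro Inter_lower) (simp add: closed_sublattice_H0_iff)

lemma fbl_delta_FBL: "fbl_delta x \<in> carrier FBL"
  by (auto simp: carrier_FBL)

lemma fun_sublattice_FBL: "fun_sublattice (carrier (FBL :: 'e::banach dual_fun vlattice))"
proof
  \<comment> \<open>The carrier of \<open>H0\<close> itself belongs to the intersected family, so
    the intersection lies inside it.\<close>
  have "fnorm_closed (carrier (H0 :: 'e dual_fun vlattice))" by (simp add: fnorm_closed_def)
  then show "carrier FBL \<subseteq> carrier (H0 :: 'e dual_fun vlattice)"
    by (intro FBL_least fun_sublattice_H0) (auto simp: fbl_delta_H0)
qed (auto simp: carrier_FBL closed_sublattice_H0_iff fun_sublattice.zero fun_sublattice.add
    fun_sublattice.scale fun_sublattice.max)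

lemma fnorm_closed_FBL: "fnorm_closed (carrier FBL)"
  unfolding fnorm_closed_def carrier_FBL closed_sublattice_H0_iff by blast

lemma FBL_eq: "H0\<lparr>carrier := carrier FBL\<rparr> = FBL"
  by (simp add: FBL_def)

interpretation FBL: fun_sublattice "carrier (FBL :: 'e::banach dual_fun vlattice)"
  rewrites "H0\<lparr>carrier := carrier FBL\<rparr> = (FBL :: 'e::banach dual_fun vlattice)"
  by (rule fun_sublattice_FBL) (rule FBL_eq)

lemma FBL_simps [simp]:
  "\<zero>\<^bsub>FBL\<^esub> = (\<lambda>_. 0)" "f \<oplus>\<^bsub>FBL\<^esub> g = (\<lambda>\<phi>. f \<phi> + g \<phi>)" "a \<odot>\<^bsub>FBL\<^esub> f = (\<lambda>\<phi>. a * f \<phi>)"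
  "vle FBL f g \<longleftrightarrow> f \<le> g" "vnorm FBL f = fnorm f"
  by (simp_all add: FBL_def)

lemma fun_sublattice_represents_lim: "fun_sublattice {f. \<exists>x. represents_lim f x}"
proof
  show "(\<lambda>_. 0) \<in> {f. \<exists>x. represents_lim f x}"
    using represents_lim_scale[OF represents_lim_delta, of 0] by auto
qed (auto intro: represents_lim_H0 represents_lim_add represents_lim_scale represents_lim_max)

lemma FBL_represents_lim: "f \<in> carrier FBL \<Longrightarrow> \<exists>x. represents_lim f x"
  using FBL_least[OF fun_sublattice_represents_lim represents_lim_closed] represents_lim_delta by blast

lemma FBL_hom_scale:
  assumes "lattice_hom FBL type_lattice b" "f \<in> carrier FBL"
  shows "b (\<lambda>\<phi>. c * f \<phi>) = c *\<^sub>R b f"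
  using assms by (simp add: lattice_hom_def)

lemma FBL_homD:
  assumes b: "lattice_hom FBL type_lattice b" and f: "f \<in> carrier FBL" and g: "g \<in> carrier FBL"
  shows "b (\<lambda>\<phi>. f \<phi> + g \<phi>) = b f + b g"
    and "b (\<lambda>\<phi>. max (f \<phi>) (g \<phi>)) = sup (b f) (b g)" and "b (f - g) = b f - b g"
    and "f \<le> g \<Longrightarrow> b f \<le> b g"
proof -
  have add: "b (\<lambda>\<phi>. f \<phi> + g \<phi>) = b f + b g" if "g \<in> carrier FBL" for g
    using b f that by (simp add: lattice_hom_def)
  show "b (\<lambda>\<phi>. f \<phi> + g \<phi>) = b f + b g" by (rule add[OF g])
  show max: "b (\<lambda>\<phi>. max (f \<phi>) (g \<phi>)) = sup (b f) (b g)"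
    using b f g by (simp add: lattice_hom_def)
  show "b (f - g) = b f - b g"
    using add[OF FBL.scale[OF g, of "-1"]] FBL_hom_scale[OF b g, of "-1"] by (simp add: fun_diff_def)
  assume "f \<le> g"
  then have "(\<lambda>\<phi>. max (f \<phi>) (g \<phi>)) = g" by (auto simp: le_fun_def max_def)
  with max have "sup (b f) (b g) = b g" by simp
  then show "b f \<le> b g" by (simp add: le_iff_sup)
qed

lemma FBL_hom_tendsto:
  fixes b :: "'e::banach dual_fun \<Rightarrow> 'a::banach_lattice"
  assumes b: "lattice_hom FBL type_lattice b" and s: "\<And>n. s n \<in> carrier FBL" and l: "l \<in> carrier FBL"
    and lim: "(\<lambda>n. fnorm (s n - l)) \<longlonglongrightarrow> 0"
  shows "(\<lambda>n. b (s n)) \<longlonglongrightarrow> b l"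
proof -
  obtain K where "\<forall>f\<in>carrier FBL. norm (b f) \<le> K * fnorm f"
    using b by (auto simp: lattice_hom_def)
  then have K: "norm (b f) \<le> K * fnorm f" if "f \<in> carrier FBL" for f
    using that by blast
  have "(\<lambda>n. b (s n) - b l) \<longlonglongrightarrow> 0"
  proof (rule Lim_null_comparison)
    show "\<forall>\<^sub>F n in sequentially. norm (b (s n) - b l) \<le> K * fnorm (s n - l)"
      using K[OF FBL.diff[OF s l]] by (simp add: FBL_homD(3)[OF b s l])
    show "(\<lambda>n. K * fnorm (s n - l)) \<longlonglongrightarrow> 0" using tendsto_mult_left[OF lim, of K] by simp
  qed
  then show ?thesis by (simp add: LIM_zero_iff)
qed

text \<open>Each homomorphism law is a closure property of \<open>represents_lim\<close> followed by
  uniqueness, which is what \<open>eqI\<close> packages; infima are reduced to suprema by negation.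
  The norm inequality gives the bound 1, and \<open>restrict\<close> provides
  extensionality.\<close>

lemma fbl_beta_exists:
  obtains b :: "'a::banach_lattice dual_fun \<Rightarrow> 'a"
  where "b \<in> extensional (carrier FBL)" "lattice_hom FBL type_lattice b" "\<And>x. b (fbl_delta x) = x"
proof -
  define b :: "'a dual_fun \<Rightarrow> 'a" where "b = restrict (\<lambda>f. THE x. represents_lim f x) (carrier FBL)"
  have eqI: "b f = x" if "f \<in> carrier FBL" "represents_lim f x" for f x
    using that represents_lim_unique by (auto simp: b_def intro: the_equality)
  have rep: "represents_lim f (b f)" if "f \<in> carrier FBL" for f
    using FBL_represents_lim[OF that] eqI[OF that] by blast
  have scale: "b (\<lambda>\<phi>. c * f \<phi>) = c *\<^sub>R b f" if "f \<in> carrier FBL" for c f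
    using that by (intro eqI FBL.scale represents_lim_scale rep)
  have max: "b (\<lambda>\<phi>. max (f \<phi>) (g \<phi>)) = sup (b f) (b g)" if "f \<in> carrier FBL" "g \<in> carrier FBL" for f g
    using that by (intro eqI FBL.max represents_lim_max rep)
  have min: "b (\<lambda>\<phi>. min (f \<phi>) (g \<phi>)) = inf (b f) (b g)" if fg: "f \<in> carrier FBL" "g \<in> carrier FBL" for f g
  proof -
    have neg: "(\<lambda>\<phi>. -1 * f \<phi>) \<in> carrier FBL" "(\<lambda>\<phi>. -1 * g \<phi>) \<in> carrier FBL"
      using fg by (simp_all only: FBL.scale)
    have "b (\<lambda>\<phi>. -1 * max (-1 * f \<phi>) (-1 * g \<phi>)) = -1 *\<^sub>R sup (-1 *\<^sub>R b f) (-1 *\<^sub>R b g)"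
      by (simp only: scale[OF FBL.max[OF neg]] max[OF neg] scale fg)
    moreover have "(\<lambda>\<phi>. -1 * max (-1 * f \<phi>) (-1 * g \<phi>)) = (\<lambda>\<phi>. min (f \<phi>) (g \<phi>))"
      by (auto simp: max_def min_def)
    ultimately show ?thesis by (simp only: scaleR_minus1_left inf_eq_neg_sup)
  qed
  have "b (\<lambda>\<phi>. f \<phi> + g \<phi>) = b f + b g" if "f \<in> carrier FBL" "g \<in> carrier FBL" for f g
    using that by (intro eqI FBL.add represents_lim_add rep)
  moreover have "norm (b f) \<le> 1 * fnorm f" if "f \<in> carrier FBL" for f
    using represents_lim_norm_le[OF rep[OF that]] by simp
  ultimately have "lattice_hom FBL type_lattice b"
    unfolding lattice_hom_def using scale max min by (intro conjI ballI allI exI[of _ 1]) auto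
  moreover have "b (fbl_delta x) = x" for x
    by (rule eqI[OF fbl_delta_FBL represents_lim_delta])
  ultimately show thesis by (intro that) (auto simp: b_def)
qed

text \<open>The set where two homomorphisms agree is a closed sublattice containing the evaluations,
  hence all of \<open>FBL\<close>.\<close>

lemma FBL_hom_unique:
  fixes b b' :: "'e::banach dual_fun \<Rightarrow> 'a::banach_lattice"
  assumes b: "lattice_hom FBL type_lattice b" and b': "lattice_hom FBL type_lattice b'"
    and delta: "\<And>x. b (fbl_delta x) = b' (fbl_delta x)" and f: "f \<in> carrier FBL"
  shows "b f = b' f"
proof -
  define S where "S = {f \<in> carrier FBL. b f = b' f}"
  note hom = FBL_hom_scale[OF b] FBL_hom_scale[OF b'] FBL_homD[OF b] FBL_homD[OF b']
  have "fun_sublattice S"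
  proof
    show "(\<lambda>_. 0) \<in> S"
      using hom(1,2)[OF fbl_delta_FBL, of 0]
      by (simp add: S_def FBL.zero)
  qed (auto simp: S_def FBL.in_H0 FBL.add FBL.scale FBL.max hom)
  moreover have "fnorm_closed S"
    unfolding fnorm_closed_def
  proof (intro allI impI)
    fix s l assume s: "\<forall>n. s n \<in> S" and l: "l \<in> carrier H0" and lim: "(\<lambda>n. fnorm (s n - l)) \<longlonglongrightarrow> 0"
    have l: "l \<in> carrier FBL"
      using fnorm_closed_FBL s l lim unfolding fnorm_closed_def S_def by blast
    have "(\<lambda>n. b (s n)) \<longlonglongrightarrow> b l" "(\<lambda>n. b' (s n)) \<longlonglongrightarrow> b' l"
      using s by (intro FBL_hom_tendsto b b' l lim; simp add: S_def)+
    moreover have "b (s n) = b' (s n)" for n using s by (simp add: S_def)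
    ultimately have "b l = b' l" using LIMSEQ_unique by simp
    with l show "l \<in> S" by (simp add: S_def)
  qed
  ultimately have "carrier FBL \<subseteq> S"
    by (rule FBL_least) (auto simp: S_def fbl_delta_FBL delta)
  with f show ?thesis by (auto simp: S_def)
qed

text \<open>Existence and uniqueness justify the definite description; extensionality turns
  agreement on the carrier into equality of functions.\<close>

lemma fbl_beta:
  fixes x :: "'a::banach_lattice"
  shows "lattice_hom FBL type_lattice (fbl_beta :: 'a dual_fun \<Rightarrow> 'a)" and "fbl_beta (fbl_delta x) = x"
proof -
  obtain b :: "'a dual_fun \<Rightarrow> 'a" where b: "b \<in> extensional (carrier FBL)" "lattice_hom FBL type_lattice b"
    "\<And>x. b (fbl_delta x) = x"
    by (rule fbl_beta_exists) blast
  have "fbl_beta = b"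
    unfolding fbl_beta_def
  proof (rule the_equality)
    fix b' :: "'a dual_fun \<Rightarrow> 'a"
    assume b': "b' \<in> extensional (carrier FBL) \<and> lattice_hom FBL type_lattice b' \<and> (\<forall>x. b' (fbl_delta x) = x)"
    show "b' = b"
    proof (rule extensionalityI[of _ "carrier FBL"])
      show "b' f = b f" if "f \<in> carrier FBL" for f
        by (rule FBL_hom_unique[OF _ b(2) _ that]) (simp_all add: b' b(3))
    qed (use b b' in auto)
  qed (use b in auto)
  with b show "lattice_hom FBL type_lattice (fbl_beta :: 'a dual_fun \<Rightarrow> 'a)" "fbl_beta (fbl_delta x) = x"
    by simp_all
qed

section \<open>The kernel of the canonical map\<close>

text \<open>\<open>beta_fibre 0\<close> is the kernel and the other fibres are its cosets. The
  function \<open>beta_fibre\<close> is thus itself the homomorphism into the quotient that will be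
  lifted.\<close>

definition beta_fibre :: "'a::banach_lattice \<Rightarrow> 'a dual_fun set" where
  "beta_fibre x = {f \<in> carrier FBL. fbl_beta f = x}"

lemmas fbl_beta_scale = FBL_hom_scale[OF fbl_beta(1)]
  and fbl_beta_hom = FBL_homD[OF fbl_beta(1)]

lemma fbl_delta_fibre: "fbl_delta x \<in> beta_fibre x"
  by (simp add: beta_fibre_def fbl_delta_FBL fbl_beta)

lemma beta_fibre_inject: "beta_fibre x = beta_fibre y \<longleftrightarrow> x = y"
  using fbl_delta_fibre[of x] by (auto simp: beta_fibre_def)

lemma coset_kernel:
  assumes "f \<in> carrier FBL"
  shows "beta_fibre 0 +>\<^bsub>FBL\<^esub> f = beta_fibre (fbl_beta f)"
proof -
  have "g \<in> (\<lambda>h \<phi>. h \<phi> + f \<phi>) ` beta_fibre 0" if g: "g \<in> beta_fibre (fbl_beta f)" for g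
  proof (rule image_eqI)
    show "g = (\<lambda>\<phi>. (g - f) \<phi> + f \<phi>)" by simp
    show "g - f \<in> beta_fibre 0"
      using g assms by (simp add: beta_fibre_def fbl_beta_hom FBL.diff)
  qed
  then show ?thesis
    using assms by (auto simp: a_r_coset_def' beta_fibre_def fbl_beta_hom FBL.add)
qed

text \<open>The canonical map commutes with absolute values, so an element dominated by one of the
  kernel is sent to an element whose absolute value is at most 0. Closedness is continuity of the
  canonical map.\<close>

lemma closed_ideal_kernel: "closed_ideal FBL (beta_fibre 0)"
  unfolding closed_ideal_def
proof (intro conjI ballI impI)
  interpret Module.module real_ring "FBL :: 'a dual_fun vlattice" by (rule FBL.module)
  show "submodule (beta_fibre 0) real_ring (FBL :: 'a dual_fun vlattice)"
  proof (rule submoduleI)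
    show "beta_fibre 0 \<subseteq> carrier (FBL :: 'a dual_fun vlattice)" by (auto simp: beta_fibre_def)
    show "\<zero>\<^bsub>FBL\<^esub> \<in> beta_fibre (0::'a)"
      using fbl_beta_scale[OF fbl_delta_FBL, of 0] by (simp add: beta_fibre_def FBL.zero)
    show "f \<oplus>\<^bsub>FBL\<^esub> g \<in> beta_fibre 0" if "f \<in> beta_fibre (0::'a)" "g \<in> beta_fibre 0" for f g
      using that by (simp add: beta_fibre_def FBL.add fbl_beta_hom(1))
    show smult: "c \<odot>\<^bsub>FBL\<^esub> f \<in> beta_fibre 0" if "f \<in> beta_fibre (0::'a)" for c f
      using that by (simp add: beta_fibre_def FBL.scale fbl_beta_scale)
    show "\<ominus>\<^bsub>FBL\<^esub> f \<in> beta_fibre 0" if "f \<in> beta_fibre (0::'a)" for f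
      using smult[OF that, of "-1"] that by (simp add: beta_fibre_def[of 0] FBL.a_inv fun_Compl_def)
  qed
next
  fix g f :: "'a dual_fun"
  assume g: "g \<in> beta_fibre 0" and f: "f \<in> carrier FBL" and le: "vle FBL (vabs FBL f) (vabs FBL g)"
  have abs: "(\<lambda>\<phi>. \<bar>h \<phi>\<bar>) \<in> carrier FBL" "fbl_beta (\<lambda>\<phi>. \<bar>h \<phi>\<bar>) = sup (fbl_beta h) (- fbl_beta h)"
    if h: "h \<in> carrier FBL" for h :: "'a dual_fun"
  proof -
    have "(\<lambda>\<phi>. \<bar>h \<phi>\<bar>) = (\<lambda>\<phi>. max (h \<phi>) (-1 * h \<phi>))" by (auto simp: max_def)
    then show "(\<lambda>\<phi>. \<bar>h \<phi>\<bar>) \<in> carrier FBL" "fbl_beta (\<lambda>\<phi>. \<bar>h \<phi>\<bar>) = sup (fbl_beta h) (- fbl_beta h)"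
      using FBL.max[OF h FBL.scale[OF h]] fbl_beta_scale[OF h, of "-1"]
      by (simp_all only: fbl_beta_hom(2)[OF h FBL.scale[OF h]]) simp
  qed
  have "g \<in> carrier FBL" "fbl_beta g = 0" using g by (simp_all add: beta_fibre_def)
  with f le have "sup (fbl_beta f) (- fbl_beta f) \<le> 0"
    using fbl_beta_hom(4)[OF abs(1)[OF f] abs(1), of g] by (simp add: abs)
  then have "fbl_beta f = 0" by (simp add: order.antisym)
  with f show "f \<in> beta_fibre 0" by (simp add: beta_fibre_def)
next
  show "norm_closed FBL (beta_fibre (0::'a))"
    unfolding norm_closed_def
  proof (intro allI impI)
    fix s and l :: "'a dual_fun"
    assume s: "\<forall>n. s n \<in> beta_fibre 0" and l: "l \<in> carrier FBL" and "vtendsto FBL s l"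
    then have lim: "(\<lambda>n. fnorm (s n - l)) \<longlonglongrightarrow> 0" by (simp only: FBL.vtendsto)
    have "(\<lambda>n. fbl_beta (s n)) \<longlonglongrightarrow> fbl_beta l"
      using s by (intro FBL_hom_tendsto fbl_beta l lim) (simp add: beta_fibre_def)
    moreover have "fbl_beta (s n) = 0" for n using s by (simp add: beta_fibre_def)
    ultimately have "fbl_beta l = 0" by (simp add: LIMSEQ_const_iff)
    with l show "l \<in> beta_fibre 0" by (simp add: beta_fibre_def)
  qed
qed

section \<open>The quotient by the kernel, identified with the original lattice\<close>

abbreviation FBL_quotient :: "'a::banach_lattice dual_fun set vlattice" where
  "FBL_quotient \<equiv> quotient_lattice FBL (beta_fibre 0)"

lemma carrier_FBL_quotient: "carrier FBL_quotient = range beta_fibre"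
proof -
  have "beta_fibre x \<in> (\<lambda>f. beta_fibre (fbl_beta f)) ` carrier FBL" for x :: 'a
    by (rule image_eqI[of _ _ "fbl_delta x"]) (simp_all add: fbl_beta fbl_delta_FBL)
  moreover have "carrier (FBL_quotient :: 'a dual_fun set vlattice)
      = (\<lambda>f. beta_fibre (fbl_beta f)) ` carrier FBL"
    by (auto simp: quotient_lattice_def A_RCOSETS_def' coset_kernel)
  ultimately show ?thesis by auto
qed

lemma vle_FBL_quotient: "vle FBL_quotient (beta_fibre x) (beta_fibre y) \<longleftrightarrow> x \<le> y"
proof
  assume "vle FBL_quotient (beta_fibre x) (beta_fibre y)"
  then show "x \<le> y" by (auto simp: quotient_lattice_def beta_fibre_def fbl_beta_hom)
next
  assume "x \<le> y"
  \<comment> \<open>Pointwise comparison of \<open>fbl_delta x\<close> with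
    \<open>fbl_delta y\<close> fails unless \<open>x = y\<close>, as the dual contains negatives.
    The maximum lies above \<open>fbl_delta x\<close> and stays in the fibre over \<open>y\<close>
    because \<open>sup x y = y\<close>.\<close>
  let ?g = "\<lambda>\<phi>. max (fbl_delta x \<phi>) (fbl_delta y \<phi>)"
  have "?g \<in> beta_fibre y"
    using \<open>x \<le> y\<close> by (simp add: beta_fibre_def FBL.max fbl_delta_FBL fbl_beta_hom fbl_beta sup_absorb2)
  moreover have "fbl_delta x \<le> ?g" by (simp add: le_fun_def)
  ultimately show "vle FBL_quotient (beta_fibre x) (beta_fibre y)"
    using fbl_delta_fibre[of x] by (auto simp: quotient_lattice_def)
qed

lemma add_FBL_quotient: "beta_fibre x \<oplus>\<^bsub>FBL_quotient\<^esub> beta_fibre y = beta_fibre (x + y)"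
proof -
  have "h \<in> beta_fibre x <+>\<^bsub>FBL\<^esub> beta_fibre y" if h: "h \<in> beta_fibre (x + y)" for h
  proof -
    have "h - fbl_delta y \<in> beta_fibre x"
      using h by (simp add: beta_fibre_def FBL.diff fbl_delta_FBL fbl_beta_hom fbl_beta)
    moreover have "h = (h - fbl_delta y) \<oplus>\<^bsub>FBL\<^esub> fbl_delta y" by simp
    ultimately show ?thesis using fbl_delta_fibre[of y] unfolding set_add_def' by blast
  qed
  then show ?thesis
    by (auto simp: quotient_lattice_def) (auto simp: set_add_def' beta_fibre_def FBL.add fbl_beta_hom)
qed

text \<open>All cosets in the defining union coincide, and the union is not empty because the fibre
  contains \<open>fbl_delta x\<close>.\<close>

lemma smult_FBL_quotient: "c \<odot>\<^bsub>FBL_quotient\<^esub> beta_fibre x = beta_fibre (c *\<^sub>R x)"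
proof -
  have "beta_fibre 0 +>\<^bsub>FBL\<^esub> (c \<odot>\<^bsub>FBL\<^esub> f) = beta_fibre (c *\<^sub>R x)" if "f \<in> beta_fibre x" for f
    using that by (simp add: beta_fibre_def[of x] coset_kernel FBL.scale fbl_beta_scale)
  then show ?thesis
    using fbl_delta_fibre[of x] by (auto simp: quotient_lattice_def simp del: FBL_simps)
qed

text \<open>By \<open>vle_FBL_quotient\<close> the fibre map is an order isomorphism onto the
  quotient, and joins depend on the order alone.\<close>

lemma vjoin_FBL_quotient: "vjoin FBL_quotient (beta_fibre x) (beta_fibre y) = beta_fibre (sup x y)"
proof -
  have Upper: "Upper (vorder FBL_quotient) {beta_fibre x, beta_fibre y} = beta_fibre ` {z. x \<le> z \<and> y \<le> z}"
    by (auto simp: Upper_def vorder_def carrier_FBL_quotient vle_FBL_quotient)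
  show ?thesis
    unfolding vjoin_def join_def Lattice.sup_def Upper
  proof (rule some_equality)
    show "least (vorder FBL_quotient) (beta_fibre (sup x y)) (beta_fibre ` {z. x \<le> z \<and> y \<le> z})"
      by (auto simp: least_def vorder_def carrier_FBL_quotient vle_FBL_quotient)
    fix D assume D: "least (vorder FBL_quotient) D (beta_fibre ` {z. x \<le> z \<and> y \<le> z})"
    then obtain z where z: "D = beta_fibre z" "x \<le> z" "y \<le> z"
      by (auto simp: least_def)
    have "beta_fibre (sup x y) \<in> beta_fibre ` {z. x \<le> z \<and> y \<le> z}" by simp
    with D have "vle FBL_quotient D (beta_fibre (sup x y))"
      by (simp only: least_def vorder_def gorder.simps)
    with z show "D = beta_fibre (sup x y)"
      by (auto simp: vle_FBL_quotient intro!: arg_cong[of _ _ beta_fibre] order.antisym)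
  qed
qed

lemma vmeet_FBL_quotient: "vmeet FBL_quotient (beta_fibre x) (beta_fibre y) = beta_fibre (inf x y)"
proof -
  have Lower: "Lower (vorder FBL_quotient) {beta_fibre x, beta_fibre y} = beta_fibre ` {z. z \<le> x \<and> z \<le> y}"
    by (auto simp: Lower_def vorder_def carrier_FBL_quotient vle_FBL_quotient)
  show ?thesis
    unfolding vmeet_def meet_def Lattice.inf_def Lower
  proof (rule some_equality)
    show "greatest (vorder FBL_quotient) (beta_fibre (inf x y)) (beta_fibre ` {z. z \<le> x \<and> z \<le> y})"
      by (auto simp: greatest_def vorder_def carrier_FBL_quotient vle_FBL_quotient)
    fix D assume D: "greatest (vorder FBL_quotient) D (beta_fibre ` {z. z \<le> x \<and> z \<le> y})"
    then obtain z where z: "D = beta_fibre z" "z \<le> x" "z \<le> y"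
      by (auto simp: greatest_def)
    have "beta_fibre (inf x y) \<in> beta_fibre ` {z. z \<le> x \<and> z \<le> y}" by simp
    with D have "vle FBL_quotient (beta_fibre (inf x y)) D"
      by (simp only: greatest_def vorder_def gorder.simps)
    with z show "D = beta_fibre (inf x y)"
      by (auto simp: vle_FBL_quotient intro!: arg_cong[of _ _ beta_fibre] order.antisym)
  qed
qed

text \<open>The representative \<open>fbl_delta x\<close> bounds the infimum. The fibre map
  therefore has norm at most one, which preserves the constant \<open>lam\<close> in the
  lift.\<close>

lemma vnorm_FBL_quotient_le: "vnorm FBL_quotient (beta_fibre x) \<le> norm x"
proof -
  have "(INF f\<in>beta_fibre x. fnorm f) \<le> fnorm (fbl_delta x)"
    by (rule cINF_lower) (auto intro: fbl_delta_fibre bdd_belowI2 fnorm_nonneg)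
  also have "\<dots> \<le> norm x" by (rule fbl_delta_H0)
  finally show ?thesis by (simp add: quotient_lattice_def)
qed

lemma lattice_hom_beta_fibre: "lattice_hom type_lattice FBL_quotient beta_fibre"
  unfolding lattice_hom_def
  by (auto simp: carrier_FBL_quotient add_FBL_quotient smult_FBL_quotient vjoin_FBL_quotient
      vmeet_FBL_quotient intro!: exI[of _ 1] vnorm_FBL_quotient_le)

lemma op_norm_beta_fibre_le: "op_norm type_lattice FBL_quotient beta_fibre \<le> 1"
  unfolding op_norm_def
proof (rule cSUP_least)
  show "{x \<in> carrier type_lattice. vnorm type_lattice x \<le> 1} \<noteq> {}" by (auto intro: exI[of _ 0])
qed (auto intro: order_trans[OF vnorm_FBL_quotient_le])

theorem proposition2p2:
  fixes lam :: real
  assumes "lam \<ge> 1"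
    and "lambda_projective TYPE('a dual_fun) lam (type_lattice :: 'a::banach_lattice vlattice)"
  shows "lattice_lifting TYPE('a) lam"
proof -
  have FBL: "banach_lattice_on (FBL :: 'a dual_fun vlattice)"
    by (rule FBL.banach_lattice_on[OF fnorm_closed_FBL])
  \<comment> \<open>Projectivity is applied to \<open>FBL\<close>, the kernel of the canonical map
    and the fibre map.\<close>
  from assms(2)[unfolded lambda_projective_def, rule_format, OF FBL closed_ideal_kernel lattice_hom_beta_fibre]
  obtain \<alpha> :: "'a \<Rightarrow> 'a dual_fun" where \<alpha>: "lattice_hom type_lattice FBL \<alpha>"
    and lift: "\<forall>x\<in>carrier type_lattice. beta_fibre x = beta_fibre 0 +>\<^bsub>FBL\<^esub> \<alpha> x"
    and le: "op_norm type_lattice FBL \<alpha> \<le> lam * op_norm type_lattice (FBL_quotient :: 'a dual_fun set vlattice) beta_fibre"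
    by (elim exE conjE)
  have "\<alpha> x \<in> carrier FBL" for x using \<alpha> by (auto simp: lattice_hom_def)
  \<comment> \<open>The coset of \<open>\<alpha> x\<close> is the fibre over
    \<open>fbl_beta (\<alpha> x)\<close>, and the lifting equation makes it the fibre over
    \<open>x\<close>; distinct points have distinct fibres.\<close>
  with lift have "fbl_beta (\<alpha> x) = x" for x by (simp add: coset_kernel beta_fibre_inject)
  moreover have "op_norm type_lattice FBL \<alpha> \<le> lam"
    using order_trans[OF le mult_left_mono[OF op_norm_beta_fibre_le]] assms(1) by simp
  ultimately show ?thesis using \<alpha> unfolding lattice_lifting_def by blast
qed

end
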